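(* Let $A_N$ and $B_N$ be independent $N\times N$ random matrices ($N$ even), each sampled from the real symmetric palindromic Toeplitz ensemble, let $\{A_N,B_N\}=A_NB_N+B_NA_N$, and let $$M_{2m}=\lim_{N\to\infty}\frac{1}{N^{2m+1}}\mathbb{E}\left[\mathrm{Tr}\left(\{A_N,B_N\}^{2m}\right)\right].$$ Then $$M_{2m}=4^m\left((2m-1)!!\right)^2.$$
   Context: The $N\times N$ real symmetric palindromic Toeplitz ensemble (PTE), with $N$ even, consists of matrices $(a_{ij})$ with entries parametrized by $b_0,b_1,\dots,b_{N/2-1}$, which are i.i.d. random variables with mean $0$, variance $1$ and finite higher moments: $$a_{ij}=\begin{cases} b_{|i-j|} & \text{if } 0\le|i-j|\le \frac N2-1,\\ b_{N-1-|i-j|} & \text{if } \frac N2\le|i-j|\le N-1.\end{cases}$$ The quantity $M_{2m}$ is called the limiting expected $2m$-th moment of $\{\mathrm{PTE},\mathrm{PTE}\}$; it is the limit of the expected $2m$-th moment of the empirical spectral distribution of $\{A_N,B_N\}/N$. Here $(2m-1)!!=1\cdot3\cdots(2m-1)$. *)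

theory Defs
  imports "HOL-Probability.Probability" "Jordan_Normal_Form.Matrix"
begin

definition mat_trace :: "real mat \<Rightarrow> real" where
  "mat_trace A = (\<Sum>i<dim_row A. A $$ (i, i))"

definition anticommutator :: "real mat \<Rightarrow> real mat \<Rightarrow> real mat" where
  "anticommutator A B = A * B + B * A"

text \<open>Rows and columns are indexed by \<open>0, \<dots>, N - 1\<close>; only the differences of indices matter.\<close>

definition palindromic_toeplitz :: "nat \<Rightarrow> (nat \<Rightarrow> real) \<Rightarrow> real mat" where
  "palindromic_toeplitz N b = mat N N (\<lambda>(i, j).
     let d = nat \<bar>int i - int j\<bar>
     in if d \<le> N div 2 - 1 then b d else b (N - 1 - d))"

definition standardized_law :: "real measure \<Rightarrow> bool" where
  "standardized_law \<mu> \<longleftrightarrow>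
     prob_space \<mu> \<and> sets \<mu> = sets borel \<and>
     (\<forall>k::nat. integrable \<mu> (\<lambda>x. x ^ k)) \<and>
     prob_space.expectation \<mu> (\<lambda>x. x) = 0 \<and>
     prob_space.variance \<mu> (\<lambda>x. x) = 1"

text \<open>\<open>A\<close> is a random matrix, defined on the probability space \<open>P\<close>, that is sampled from the
  \<open>N \<times> N\<close> real symmetric palindromic Toeplitz ensemble with entry law \<open>\<mu>\<close>.\<close>

definition sampled_from_PTE ::
    "'w measure \<Rightarrow> real measure \<Rightarrow> nat \<Rightarrow> ('w \<Rightarrow> real mat) \<Rightarrow> bool" where
  "sampled_from_PTE P \<mu> N A \<longleftrightarrow>
     (\<exists>b :: nat \<Rightarrow> 'w \<Rightarrow> real.
        prob_space.indep_vars P (\<lambda>_. borel) b {..<N div 2} \<and>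
        (\<forall>k<N div 2. distr P borel (b k) = \<mu>) \<and>
        (\<forall>\<omega>\<in>space P. A \<omega> = palindromic_toeplitz N (\<lambda>k. b k \<omega>)))"

text \<open>The type \<open>real mat\<close> carries no measurable structure, so an \<open>N \<times> N\<close> random matrix is viewed
  as a random element of the finite product of copies of the Borel line given by its entries.\<close>

definition entry_family :: "nat \<Rightarrow> real mat \<Rightarrow> nat \<times> nat \<Rightarrow> real" where
  "entry_family N A = restrict (\<lambda>p. A $$ p) ({..<N} \<times> {..<N})"

definition independent_matrices ::
    "'w measure \<Rightarrow> nat \<Rightarrow> ('w \<Rightarrow> real mat) \<Rightarrow> ('w \<Rightarrow> real mat) \<Rightarrow> bool" where
  "independent_matrices P N A B \<longleftrightarrow>
     prob_space.indep_var P
       (\<Pi>\<^sub>M p\<in>{..<N} \<times> {..<N}. borel) (\<lambda>\<omega>. entry_family N (A \<omega>))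
       (\<Pi>\<^sub>M p\<in>{..<N} \<times> {..<N}. borel) (\<lambda>\<omega>. entry_family N (B \<omega>))"

end

theory Submission
  imports Defs "HOL-Real_Asymp.Real_Asymp"
begin

text \<open>Put \<open>n = N - 1\<close>, which is odd. An entry of a palindromic Toeplitz matrix of size \<open>N\<close> depends only on
  \<open>\<plusminus>(i - j)\<close> modulo \<open>n\<close>. The matrix is therefore a symmetric circulant matrix of size \<open>n\<close> whose first
  row and column are repeated at the end. All symmetric circulants of size \<open>n\<close> are diagonalized by one common
  orthogonal basis (\<open>circ_spectral\<close>), so without the repetition \<open>A\<close> and \<open>B\<close> would commute and the trace
  would be \<open>\<Sum>k<n. (2 * x k * y k) ^ (2 * m)\<close>, where \<open>x k\<close> and \<open>y k\<close> are their eigenvalues. In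
  the common eigenbasis the repetition multiplies every factor by the identity plus \<open>1 / n\<close> times the all-ones matrix,
  and tracking entrywise bounds shows that this changes the trace by at most
  \<open>(8 * max \<bar>x\<bar> * max \<bar>y\<bar>) ^ (2 * m)\<close> (\<open>trace_anticommutator_pow\<close>). High moments of the
  eigenvalues bound the expectation of this error by a constant times \<open>N ^ (2 * m + 1 / 2)\<close>.

  Each \<open>x k\<close> is a sum of \<open>N / 2\<close> independent standardized variables with weights bounded by \<open>2\<close>,
  and its variance is \<open>n - 1\<close> for \<open>k > 0\<close>. Its \<open>2 * m\<close>-th moment is hence
  \<open>(2 * m - 1)!! * (n - 1) ^ m\<close> up to an error of order \<open>n ^ (m - 1)\<close>, uniformly in \<open>k\<close>
  (\<open>wsum_moment_approx\<close>, for \<open>m > 0\<close>; the case \<open>m = 0\<close> is immediate). By independence of \<open>A\<close> and \<open>B\<close>, each of the \<open>n - 1\<close> indices \<open>k > 0\<close>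
  contributes about \<open>4 ^ m * ((2 * m - 1)!!)\<^sup>2 * n ^ (2 * m)\<close> to the expected trace, and the index
  \<open>k = 0\<close> is negligible. Dividing by \<open>N ^ (2 * m + 1)\<close> gives the limit.\<close>

section \<open>Moments of weighted sums\<close>

text \<open>The value \<open>wsum_moment M c n p\<close> is the \<open>p\<close>-th moment of \<open>\<Sum>i<n. c i * X i\<close> for independent
  \<open>X i\<close> whose \<open>q\<close>-th moments are all \<open>M q\<close>, computed by splitting off the last summand and
  expanding binomially. No random variables occur, so the estimates below are purely algebraic.\<close>
primrec wsum_moment :: "(nat \<Rightarrow> real) \<Rightarrow> (nat \<Rightarrow> real) \<Rightarrow> nat \<Rightarrow> nat \<Rightarrow> real" where
  "wsum_moment M c 0 = (\<lambda>p. if p = 0 then 1 else 0)"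
| "wsum_moment M c (Suc n) = (\<lambda>p. \<Sum>q\<le>p. real (p choose q) * c n ^ q * M q * wsum_moment M c n (p - q))"

text \<open>The \<open>p\<close>-th moment of the standard normal law: \<open>(p - 1)!!\<close> for even \<open>p\<close> and \<open>0\<close> for odd \<open>p\<close>.\<close>
definition gauss_moment :: "nat \<Rightarrow> real" where
  "gauss_moment p = (if even p then \<Prod>k=1..p div 2. 2 * real k - 1 else 0)"

lemma gauss_moment_nonneg: "0 \<le> gauss_moment p"
  by (auto simp: gauss_moment_def intro!: prod_nonneg)

lemma gauss_moment_step:
  assumes "2 \<le> p"
  shows "gauss_moment p = (real p - 1) * gauss_moment (p - 2)"
proof (cases "even p")
  case True
  then obtain m where m: "p = 2 * Suc m" using assms
    by (metis evenE gr0_conv_Suc mult_is_0 not_numeral_le_zero zero_less_iff_neq_zero)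
  then show ?thesis by (simp add: gauss_moment_def prod.nat_ivl_Suc')
qed (use assms in \<open>simp add: gauss_moment_def\<close>)

text \<open>One step of the induction on the number of summands: an error \<open>C * u ^ (k + 1)\<close> plus
  increments of order \<open>u ^ k\<close> stays within \<open>C * (u + 1) ^ (k + 1)\<close>.\<close>
lemma increment_bound:
  fixes a b c d u :: real
  assumes "\<bar>a\<bar> \<le> C * u ^ Suc k" "\<bar>b\<bar> \<le> B * u ^ k" "\<bar>c\<bar> \<le> T * u ^ k" "\<bar>d\<bar> \<le> G * u ^ k"
    and C: "C = B + T + G" "0 \<le> C" and u: "0 \<le> u"
  shows "\<bar>a + b + c - d\<bar> \<le> C * (u + 1) ^ Suc k"
proof -
  have "\<bar>a + b + c - d\<bar> \<le> C * u ^ Suc k + B * u ^ k + T * u ^ k + G * u ^ k"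
    using assms(1-4) by linarith
  also have "\<dots> = C * (u ^ k * (u + 1))" unfolding C(1) by (simp add: algebra_simps)
  also have "\<dots> \<le> C * ((u + 1) ^ k * (u + 1))"
    using C(2) u by (intro mult_left_mono mult_right_mono power_mono) auto
  finally show ?thesis by (simp add: mult.commute)
qed

lemma sum_atMost_split3:
  fixes f :: "nat \<Rightarrow> real"
  assumes "2 \<le> p"
  shows "(\<Sum>q\<le>p. f q) = f 0 + f 1 + f 2 + (\<Sum>q=3..p. f q)"
proof -
  have "{..p} = {0,1,2} \<union> {3..p}" using assms by auto
  moreover have "sum f ({0,1,2} \<union> {3..p}) = sum f {0,1,2} + sum f {3..p}"
    by (rule sum.union_disjoint) auto
  ultimately show ?thesis by simp
qed

text \<open>The remainder of the first-order expansion of \<open>(V + x) ^ m\<close> in a bounded increment \<open>x\<close>.\<close>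
lemma power_add_remainder_le:
  fixes V x :: real
  assumes "2 \<le> m" "0 \<le> x" "x \<le> 4" "0 \<le> V" "V \<le> 4 * real (Suc n)"
  shows "\<bar>(V + x) ^ m - V ^ m - real m * x * V ^ (m - 1)\<bar>
           \<le> 8 ^ m * real (Suc n) ^ (m - 2)"
proof -
  have eq: "(V + x) ^ m - V ^ m - real m * x * V ^ (m - 1)
             = (\<Sum>q=2..m. real (m choose q) * x ^ q * V ^ (m - q))"
  proof -
    have s: "{..m} = {0,1} \<union> {2..m}" using assms by auto
    have "(V + x) ^ m = (\<Sum>q\<le>m. real (m choose q) * x ^ q * V ^ (m - q))"
      by (subst add.commute, subst binomial_ring) simp
    also have "\<dots> = (\<Sum>q\<in>{0,1}. real (m choose q) * x ^ q * V ^ (m - q))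
        + (\<Sum>q=2..m. real (m choose q) * x ^ q * V ^ (m - q))"
      unfolding s by (rule sum.union_disjoint) auto
    finally show ?thesis by simp
  qed
  have "\<bar>\<Sum>q=2..m. real (m choose q) * x ^ q * V ^ (m - q)\<bar>
          \<le> (\<Sum>q=2..m. real (m choose q) * (4 ^ m * real (Suc n) ^ (m - 2)))"
  proof (rule order_trans[OF sum_abs], rule sum_mono)
    fix q assume q: "q \<in> {2..m}"
    have "x ^ q * V ^ (m - q) \<le> 4 ^ q * (4 * real (Suc n)) ^ (m - q)"
      using assms by (intro mult_mono power_mono) auto
    also have "\<dots> = 4 ^ m * real (Suc n) ^ (m - q)"
      using q unfolding power_mult_distrib by (simp flip: power_add mult.assoc)
    also have "\<dots> \<le> 4 ^ m * real (Suc n) ^ (m - 2)"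
      using q by (intro mult_left_mono power_increasing) auto
    finally show "\<bar>real (m choose q) * x ^ q * V ^ (m - q)\<bar>
          \<le> real (m choose q) * (4 ^ m * real (Suc n) ^ (m - 2))"
      using assms by (simp add: abs_mult mult_left_mono mult.assoc)
  qed
  also have "\<dots> \<le> (\<Sum>q\<le>m. real (m choose q) * (4 ^ m * real (Suc n) ^ (m - 2)))"
    by (rule sum_mono2) auto
  also have "\<dots> = 2 ^ m * (4 ^ m * real (Suc n) ^ (m - 2))"
    by (simp add: choose_row_sum flip: sum_distrib_right of_nat_sum)
  also have "\<dots> = 8 ^ m * real (Suc n) ^ (m - 2)"
    by (simp add: flip: power_mult_distrib mult.assoc)
  finally show ?thesis using eq by simp
qed

text \<open>When the variance grows from \<open>V\<close> to \<open>V + x\<close>, the moments of the centred normal law satisfy, up to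
  the error shown, the recursion that \<open>wsum_moment\<close> obeys when a summand of variance \<open>x\<close> is added.\<close>
lemma gauss_moment_increment:
  fixes V x :: real
  assumes "3 \<le> p" "0 \<le> x" "x \<le> 4" "0 \<le> V" "V \<le> 4 * real (Suc n)"
  shows "\<bar>gauss_moment p * ((V + x) ^ (p div 2) - V ^ (p div 2))
            - real (p choose 2) * x * (gauss_moment (p - 2) * V ^ ((p - 2) div 2))\<bar>
           \<le> gauss_moment p * 8 ^ p * real (Suc n) ^ ((p - 3) div 2)"
proof (cases "even p")
  case False
  then show ?thesis using assms by (simp add: gauss_moment_def)
next
  case True
  then obtain m where m: "p = 2 * m" by blast
  have m2: "2 \<le> m" using m assms by simp
  have ch: "real (p choose 2) = real m * (real p - 1)"
    using m m2 by (simp add: choose_two of_nat_diff)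
  have "gauss_moment p * ((V + x) ^ (p div 2) - V ^ (p div 2))
            - real (p choose 2) * x * (gauss_moment (p - 2) * V ^ ((p - 2) div 2))
        = gauss_moment p * ((V + x) ^ m - V ^ m - real m * x * V ^ (m - 1))"
  proof -
    have g: "gauss_moment p = (real p - 1) * gauss_moment (p - 2)"
      by (rule gauss_moment_step) (use m m2 in simp)
    have e: "p div 2 = m" "(p - 2) div 2 = m - 1" using m m2 by auto
    show ?thesis unfolding ch e by (subst (1 2) g) (simp only: algebra_simps)
  qed
  also have "\<bar>\<dots>\<bar> \<le> gauss_moment p * (8 ^ m * real (Suc n) ^ (m - 2))"
    unfolding abs_mult using gauss_moment_nonneg[of p] power_add_remainder_le[OF m2 assms(2-5)]
    by (simp add: mult_left_mono)
  also have "\<dots> \<le> gauss_moment p * (8 ^ p * real (Suc n) ^ (m - 2))"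
    using m gauss_moment_nonneg[of p]
    by (intro mult_left_mono mult_right_mono power_increasing) auto
  also have "m - 2 = (p - 3) div 2" using m m2 by auto
  finally show ?thesis by (simp add: mult.assoc)
qed

lemma moment_bound_of_approx:
  fixes w V S :: real
  assumes "\<bar>w - g * V ^ (p div 2)\<bar> \<le> K * S ^ ((p - 1) div 2)"
    and "0 \<le> K" "0 \<le> g" "0 \<le> V" "V \<le> 4 * S" "1 \<le> S"
  shows "\<bar>w\<bar> \<le> (K + g * 4 ^ p) * S ^ (p div 2)"
proof -
  have "\<bar>w\<bar> \<le> K * S ^ ((p - 1) div 2) + g * V ^ (p div 2)"
    using assms by (smt (verit) mult_nonneg_nonneg zero_le_power)
  also have "\<dots> \<le> K * S ^ (p div 2) + g * (4 * S) ^ (p div 2)"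
    using assms by (intro add_mono mult_left_mono power_increasing power_mono) (auto simp: div_le_mono)
  also have "\<dots> \<le> K * S ^ (p div 2) + g * (4 ^ p * S ^ (p div 2))"
    unfolding power_mult_distrib using assms
    by (intro add_left_mono mult_left_mono mult_right_mono power_increasing) auto
  finally show ?thesis by (simp add: algebra_simps)
qed

lemma sum_squares_bounds:
  fixes c :: "nat \<Rightarrow> real"
  assumes "\<forall>i<n. \<bar>c i\<bar> \<le> 2"
  shows "0 \<le> (\<Sum>i<n. (c i)\<^sup>2)" "(\<Sum>i<n. (c i)\<^sup>2) \<le> 4 * real (Suc n)"
proof -
  show "0 \<le> (\<Sum>i<n. (c i)\<^sup>2)" by (rule sum_nonneg) simp
  have "(\<Sum>i<n. (c i)\<^sup>2) \<le> (\<Sum>i<n. 4)"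
    using assms abs_le_square_iff[of _ "2::real"] by (intro sum_mono) auto
  then show "(\<Sum>i<n. (c i)\<^sup>2) \<le> 4 * real (Suc n)" by simp
qed

context
  fixes M :: "nat \<Rightarrow> real"
  assumes M: "M 0 = 1" "M 1 = 0" "M 2 = 1"
begin

lemma wsum_moment_0: "wsum_moment M c n 0 = 1"
  by (induction n) (simp_all add: M)

lemma wsum_moment_1: "wsum_moment M c n (Suc 0) = 0"
  using M by (induction n) (simp_all add: wsum_moment_0)

lemma wsum_moment_2: "wsum_moment M c n 2 = (\<Sum>i<n. (c i)\<^sup>2)"
proof (induction n)
  case (Suc n)
  then show ?case using M wsum_moment_1[of c n]
    by (simp add: sum_atMost_split3 wsum_moment_0)
qed simp

text \<open>Quantitative moment form of the central limit theorem: the moments of a sum of independent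
  standardized variables with weights bounded by \<open>2\<close> agree with those of the normal law of the same
  variance, up to an error of order \<open>n ^ ((p - 1) div 2)\<close>. For even \<open>p\<close> this is one power of \<open>n\<close> below
  the leading order \<open>n ^ (p div 2)\<close>. The constant depends on the moments \<open>M\<close> and on \<open>p\<close> only, which gives uniformity over the eigenvalues later on.
  In the recursion for \<open>wsum_moment\<close>, the term \<open>q = 1\<close> vanishes because \<open>M 1 = 0\<close>, the term \<open>q = 2\<close>
  gives the variance increment, and the terms \<open>q \<ge> 3\<close> have lower order. The bound uses \<open>Suc n\<close> rather
  than \<open>n\<close> because positive powers of \<open>n\<close> degenerate at \<open>n = 0\<close>, where the induction starts.\<close>
lemma wsum_moment_approx:
  "\<exists>K\<ge>0. \<forall>c n. (\<forall>i<n. \<bar>c i\<bar> \<le> 2) \<longrightarrow>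
     \<bar>wsum_moment M c n p - gauss_moment p * (\<Sum>i<n. (c i)\<^sup>2) ^ (p div 2)\<bar>
       \<le> K * real (Suc n) ^ ((p - 1) div 2)"
proof (induction p rule: less_induct)
  case (less p)
  consider "p = 0" | "p = 1" | "p = 2" | "3 \<le> p" by linarith
  then show ?case
  proof cases
    case 1
    then show ?thesis by (intro exI[of _ 0]) (simp add: wsum_moment_0 gauss_moment_def)
  next
    case 2
    then show ?thesis by (intro exI[of _ 0]) (simp add: wsum_moment_1 gauss_moment_def)
  next
    case 3
    then show ?thesis by (intro exI[of _ 0]) (simp add: wsum_moment_2 gauss_moment_def)
  next
    case p3: 4
    let ?V = "\<lambda>c n. \<Sum>i<n. (c i :: real)\<^sup>2"
    obtain K where K: "\<And>r. r < p \<Longrightarrow> K r \<ge> 0"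
      "\<And>r c n. r < p \<Longrightarrow> (\<forall>i<n. \<bar>c i\<bar> \<le> 2) \<Longrightarrow>
       \<bar>wsum_moment M c n r - gauss_moment r * ?V c n ^ (r div 2)\<bar>
         \<le> K r * real (Suc n) ^ ((r - 1) div 2)"
      using less.IH by metis
    define L where "L r = K r + gauss_moment r * 4 ^ r" for r
    note V = sum_squares_bounds
    have L: "\<bar>wsum_moment M c n r\<bar> \<le> L r * real (Suc n) ^ (r div 2)"
      if r: "r < p" and c: "\<forall>i<n. \<bar>c i\<bar> \<le> 2" for r c n
      unfolding L_def using K(1)[OF r] gauss_moment_nonneg[of r] V[OF c]
      by (intro moment_bound_of_approx[OF K(2)[OF r c]]) auto
    define T where "T = (\<Sum>q=3..p. real (p choose q) * 2 ^ q * \<bar>M q\<bar> * L (p - q))"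
    define C where "C = real (p choose 2) * 4 * K (p - 2) + T + gauss_moment p * 8 ^ p"
    define a where "a = (p - 3) div 2"
    have a: "(p - 1) div 2 = Suc a" using p3 unfolding a_def by (cases p) auto
    have L0: "0 \<le> L r" if "r < p" for r
      using K(1)[OF that] gauss_moment_nonneg[of r] by (simp add: L_def)
    have T0: "0 \<le> T" unfolding T_def using p3 by (intro sum_nonneg mult_nonneg_nonneg L0) auto
    have C0: "0 \<le> C"
      using T0 K(1)[of "p-2"] gauss_moment_nonneg[of p] p3 by (simp add: C_def)
    have main: "\<bar>wsum_moment M c n p - gauss_moment p * ?V c n ^ (p div 2)\<bar>
         \<le> C * real (Suc n) ^ Suc a" if "\<forall>i<n. \<bar>c i\<bar> \<le> 2" for c n
      using that
    proof (induction n)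
      case 0
      have "p div 2 \<noteq> 0" using p3 by simp
      then show ?case using p3 C0 by (simp add: zero_power)
    next
      case (Suc n)
      then have c: "\<forall>i<n. \<bar>c i\<bar> \<le> 2" by simp
      have cn: "\<bar>c n\<bar> \<le> 2" using Suc.prems by simp
      then have cn2: "(c n)\<^sup>2 \<le> 4" using abs_le_square_iff[of "c n" "2::real"] by simp
      let ?w = "wsum_moment M c n" and ?v = "?V c n"
      let ?R = "\<Sum>q=3..p. real (p choose q) * c n ^ q * M q * ?w (p - q)"
      let ?G = "gauss_moment p * ((?v + (c n)\<^sup>2) ^ (p div 2) - ?v ^ (p div 2))
            - real (p choose 2) * (c n)\<^sup>2 * (gauss_moment (p - 2) * ?v ^ ((p - 2) div 2))"
      let ?E = "?w (p - 2) - gauss_moment (p - 2) * ?v ^ ((p - 2) div 2)"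
      have w: "wsum_moment M c (Suc n) p = ?w p + real (p choose 2) * (c n)\<^sup>2 * ?w (p - 2) + ?R"
        using p3 M by (simp add: sum_atMost_split3)
      have R: "\<bar>?R\<bar> \<le> T * real (Suc n) ^ a"
        unfolding T_def sum_distrib_right
      proof (rule order_trans[OF sum_abs], rule sum_mono)
        fix q assume q: "q \<in> {3..p}"
        have "\<bar>?w (p - q)\<bar> \<le> L (p - q) * real (Suc n) ^ ((p - q) div 2)"
          using q p3 c by (intro L) auto
        also have "\<dots> \<le> L (p - q) * real (Suc n) ^ a"
          unfolding a_def using q p3
          by (intro mult_left_mono power_increasing div_le_mono L0) auto
        finally have "real (p choose q) * \<bar>c n\<bar> ^ q * \<bar>M q\<bar> * \<bar>?w (p - q)\<bar>
          \<le> real (p choose q) * 2 ^ q * \<bar>M q\<bar> * (L (p - q) * real (Suc n) ^ a)"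
          using cn by (intro mult_mono power_mono) auto
        then show "\<bar>real (p choose q) * c n ^ q * M q * ?w (p - q)\<bar>
          \<le> real (p choose q) * 2 ^ q * \<bar>M q\<bar> * L (p - q) * real (Suc n) ^ a"
          by (simp add: abs_mult power_abs mult.assoc)
      qed
      have G: "\<bar>?G\<bar> \<le> gauss_moment p * 8 ^ p * real (Suc n) ^ a"
        unfolding a_def using V[OF c] cn2 p3 by (intro gauss_moment_increment) auto
      have "(p - 2 - 1) div 2 = a" by (simp add: a_def)
      then have "\<bar>?E\<bar> \<le> K (p - 2) * real (Suc n) ^ a"
        using K(2)[of "p - 2" n c] c p3 by simp
      then have E: "\<bar>real (p choose 2) * (c n)\<^sup>2 * ?E\<bar>
           \<le> real (p choose 2) * 4 * (K (p - 2) * real (Suc n) ^ a)"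
        unfolding abs_mult using cn2 by (intro mult_mono) auto
      then have E': "\<bar>real (p choose 2) * (c n)\<^sup>2 * ?E\<bar>
           \<le> real (p choose 2) * 4 * K (p - 2) * real (Suc n) ^ a"
        by (simp only: mult.assoc)
      have "wsum_moment M c (Suc n) p - gauss_moment p * ?V c (Suc n) ^ (p div 2)
          = (?w p - gauss_moment p * ?v ^ (p div 2))
            + real (p choose 2) * (c n)\<^sup>2 * ?E + ?R - ?G"
        unfolding w by (simp add: algebra_simps)
      also have "\<bar>\<dots>\<bar> \<le> C * (real (Suc n) + 1) ^ Suc a"
        by (rule increment_bound[OF Suc.IH[OF c] E' R G C_def C0]) simp
      finally show ?case by (simp only: of_nat_Suc[of "Suc n"] add.commute)
    qed
    then show ?thesis using C0 a by auto
  qed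
qed

lemma wsum_moment_bound:
  "\<exists>L\<ge>0. \<forall>c n. (\<forall>i<n. \<bar>c i\<bar> \<le> 2) \<longrightarrow> \<bar>wsum_moment M c n p\<bar> \<le> L * real (Suc n) ^ (p div 2)"
proof -
  obtain K where K: "0 \<le> K" "\<And>c n. (\<forall>i<n. \<bar>c i\<bar> \<le> 2) \<Longrightarrow>
     \<bar>wsum_moment M c n p - gauss_moment p * (\<Sum>i<n. (c i)\<^sup>2) ^ (p div 2)\<bar>
       \<le> K * real (Suc n) ^ ((p - 1) div 2)"
    using wsum_moment_approx[of p] by blast
  have "\<bar>wsum_moment M c n p\<bar> \<le> (K + gauss_moment p * 4 ^ p) * real (Suc n) ^ (p div 2)"
    if c: "\<forall>i<n. \<bar>c i\<bar> \<le> 2" for c n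
    using K(1) gauss_moment_nonneg[of p] sum_squares_bounds[OF c]
    by (intro moment_bound_of_approx[OF K(2)[OF c]]) auto
  moreover have "0 \<le> K + gauss_moment p * 4 ^ p"
    using K(1) gauss_moment_nonneg[of p] by simp
  ultimately show ?thesis by blast
qed

end

context prob_space
begin

lemma weighted_sum_moments:
  fixes b :: "nat \<Rightarrow> 'a \<Rightarrow> real" and c :: "nat \<Rightarrow> real"
  assumes indep: "indep_vars (\<lambda>_. borel) b {..<h}"
    and law: "\<And>k. k < h \<Longrightarrow> distr M borel (b k) = \<mu>"
    and int: "\<And>q. integrable \<mu> (\<lambda>x. x ^ q)"
    and "n \<le> h"
  shows "integrable M (\<lambda>\<omega>. (\<Sum>i<n. c i * b i \<omega>) ^ p)
    \<and> expectation (\<lambda>\<omega>. (\<Sum>i<n. c i * b i \<omega>) ^ p) = wsum_moment (\<lambda>q. \<integral>x. x ^ q \<partial>\<mu>) c n p"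
  using \<open>n \<le> h\<close>
proof (induction n arbitrary: p)
  case 0
  show ?case by (cases p) (auto simp: prob_space)
next
  case (Suc n)
  let ?X = "\<lambda>i \<omega>. c i * b i \<omega>" and ?S = "\<lambda>\<omega>. \<Sum>i<n. c i * b i \<omega>"
  have rv: "random_variable borel (b n)"
    using indep Suc.prems by (auto simp: indep_vars_def)
  have "indep_vars (\<lambda>_. borel) b (insert n {..<n})"
    by (rule indep_vars_subset[OF indep]) (use Suc.prems in auto)
  then have "indep_vars (\<lambda>_. borel) ?X (insert n {..<n})"
    by (rule indep_vars_compose2[where Y="\<lambda>i x. c i * x"]) simp
  then have ind: "indep_var borel (?X n) borel ?S"
    by (rule indep_vars_sum[rotated 2]) auto
  have ind': "indep_var borel (\<lambda>\<omega>. ?X n \<omega> ^ q) borel (\<lambda>\<omega>. ?S \<omega> ^ r)" for q r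
    using indep_var_compose[OF ind, of "\<lambda>x. x ^ q" borel "\<lambda>x. x ^ r" borel] by (simp add: comp_def)
  have mu: "(\<integral>x. x ^ q \<partial>\<mu>) = expectation (\<lambda>\<omega>. b n \<omega> ^ q)" "integrable M (\<lambda>\<omega>. b n \<omega> ^ q)" for q
    using law[of n] int[of q] Suc.prems rv
    by (auto simp: integral_distr integrable_distr_eq dest!: sym[of _ \<mu>])
  have intX: "integrable M (\<lambda>\<omega>. ?X n \<omega> ^ q)" for q
    unfolding power_mult_distrib by (intro integrable_mult_right mu)
  have IH: "integrable M (\<lambda>\<omega>. ?S \<omega> ^ q)"
    "expectation (\<lambda>\<omega>. ?S \<omega> ^ q) = wsum_moment (\<lambda>q. \<integral>x. x ^ q \<partial>\<mu>) c n q" for q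
    using Suc.IH[of q] Suc.prems by auto
  have expand: "(\<Sum>i<Suc n. c i * b i \<omega>) ^ p
      = (\<Sum>q\<le>p. real (p choose q) * (?X n \<omega> ^ q * ?S \<omega> ^ (p - q)))" for \<omega>
    by (simp add: add.commute[of "?S \<omega>"] binomial_ring mult.assoc)
  have int: "integrable M (\<lambda>\<omega>. ?X n \<omega> ^ q * ?S \<omega> ^ r)" for q r
    by (rule indep_var_integrable[OF ind' intX IH(1)])
  have ex: "expectation (\<lambda>\<omega>. ?X n \<omega> ^ q * ?S \<omega> ^ r)
     = c n ^ q * (\<integral>x. x ^ q \<partial>\<mu>) * wsum_moment (\<lambda>q. \<integral>x. x ^ q \<partial>\<mu>) c n r" for q r
    using indep_var_lebesgue_integral[OF ind' intX IH(1), of q r]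
    by (simp add: power_mult_distrib mu IH)
  show ?case unfolding expand
    by (auto simp: int ex mult.assoc)
qed

end

section \<open>Spectral decomposition of palindromic Toeplitz matrices\<close>

text \<open>The argument of the \<open>a\<close>-th power of the primitive \<open>n\<close>-th root of unity \<open>cis (2 * pi / n)\<close>.\<close>
definition root_angle :: "nat \<Rightarrow> int \<Rightarrow> real" where
  "root_angle n a = 2 * pi * real_of_int a / real n"

lemma sum_cis_root_angle:
  assumes "0 < n"
  shows "(\<Sum>k<n. cis (root_angle n (int k * a))) = (if int n dvd a then of_nat n else 0)"
proof -
  define z where "z = cis (root_angle n a)"
  have pw: "cis (root_angle n (int k * a)) = z ^ k" for k
    by (simp add: z_def Complex.DeMoivre root_angle_def mult_ac)
  have zn: "z ^ n = 1"
    using assms cis_multiple_2pi[of "real_of_int a"] by (simp add: z_def Complex.DeMoivre root_angle_def mult_ac)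
  have "z = 1 \<longleftrightarrow> int n dvd a"
  proof
    assume "z = 1"
    then have "cos (root_angle n a) = 1" by (simp add: z_def cis.ctr complex_eq_iff)
    then obtain q :: int where "root_angle n a = of_int q * 2 * pi"
      using cos_one_2pi_int by blast
    then have "real_of_int a = real_of_int (q * int n)"
      using assms by (simp add: root_angle_def field_simps)
    then have "a = q * int n" by (simp only: of_int_eq_iff)
    then show "int n dvd a" by simp
  next
    assume "int n dvd a"
    then obtain q where "a = int n * q" by blast
    then show "z = 1"
      using assms cis_multiple_2pi[of "real_of_int q"] by (simp add: z_def root_angle_def mult_ac)
  qed
  then show ?thesis using zn by (auto simp: pw sum_gp_strict)
qed

lemma sum_cos_root_angle:
  assumes "0 < n"
  shows "(\<Sum>k<n. cos (root_angle n (int k * a))) = (if int n dvd a then real n else 0)"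
  using arg_cong[OF sum_cis_root_angle[OF assms, of a], of Re] by (simp add: if_distrib cong: if_cong)

lemma sum_sin_root_angle:
  assumes "0 < n"
  shows "(\<Sum>k<n. sin (root_angle n (int k * a))) = 0"
  using arg_cong[OF sum_cis_root_angle[OF assms, of a], of Im] by (simp split: if_splits)

lemma root_angle_add: "root_angle n (a + b) = root_angle n a + root_angle n b"
  by (simp add: root_angle_def add_divide_distrib algebra_simps)

lemma root_angle_diff: "root_angle n (a - b) = root_angle n a - root_angle n b"
  by (simp add: root_angle_def diff_divide_distrib algebra_simps)

lemma cos_root_angle_reflect:
  assumes "0 < n" "d \<le> n"
  shows "cos (root_angle n (int k * int (n - d))) = cos (root_angle n (int k * int d))"
proof -
  have "root_angle n (int k * int (n - d)) = 2 * pi * real k - root_angle n (int k * int d)"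
    using assms by (simp add: root_angle_def of_nat_diff field_simps)
  moreover have "cos (2 * pi * real k) = 1" "sin (2 * pi * real k) = 0"
    using cos_int_2pin[of "int k"] sin_int_2pin[of "int k"] by auto
  ultimately show ?thesis by (simp add: cos_diff)
qed

text \<open>The kernel of the discrete Hartley transform, a real substitute for the Fourier characters: it
  diagonalizes the symmetric circulant matrices of size \<open>n\<close> without complex numbers.\<close>
definition hartley :: "nat \<Rightarrow> nat \<Rightarrow> nat \<Rightarrow> real" where
  "hartley n i k = cos (root_angle n (int i * int k)) + sin (root_angle n (int i * int k))"

lemma hartley_mult:
  "hartley n i k * hartley n j k
     = cos (root_angle n (int k * (int i - int j))) + sin (root_angle n (int k * (int i + int j)))"
proof -
  have *: "(cos x + sin x) * (cos y + sin y) = cos (x - y) + sin (x + y)" for x y :: real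
    by (simp add: cos_diff sin_add algebra_simps)
  show ?thesis unfolding hartley_def *
    by (simp add: mult.commute right_diff_distrib distrib_left flip: root_angle_add root_angle_diff)
qed

lemma hartley_commute: "hartley n i k = hartley n k i"
  by (simp add: hartley_def mult.commute)

text \<open>The sum runs over \<open>n + 1\<close> indices, one more than a full period. Index \<open>n\<close> repeats index \<open>0\<close> and
  contributes the extra summand \<open>1\<close>, so the Gram matrix is \<open>n\<close> times the identity plus the all-ones matrix.\<close>
lemma hartley_gram:
  assumes "k < n" "l < n"
  shows "(\<Sum>i<Suc n. hartley n i k * hartley n i l) = (if k = l then real n else 0) + 1"
proof -
  have n: "0 < n" using assms by simp
  have dvd: "int n dvd int k - int l \<longleftrightarrow> k = l"
    using assms by (simp add: mod_eq_dvd_iff[symmetric] flip: of_nat_mod)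
  have "(\<Sum>i<n. hartley n i k * hartley n i l) = (if k = l then real n else 0)"
    unfolding hartley_commute[of n _ k] hartley_commute[of n _ l] hartley_mult sum.distrib
      sum_cos_root_angle[OF n] sum_sin_root_angle[OF n] dvd by simp
  moreover have "hartley n n k = 1" for k
    using n sin_int_2pin[of "int k"] cos_int_2pin[of "int k"]
    by (simp add: hartley_def root_angle_def mult.assoc)
  ultimately show ?thesis by simp
qed

text \<open>The \<open>k\<close>-th eigenvalue of the symmetric circulant matrix of size \<open>n\<close> with first row \<open>a\<close>.\<close>
definition circ_eigenvalue :: "nat \<Rightarrow> (nat \<Rightarrow> real) \<Rightarrow> nat \<Rightarrow> real" where
  "circ_eigenvalue n a k = (\<Sum>d<n. a d * cos (root_angle n (int k * int d)))"

text \<open>Inversion formula. The indices \<open>i\<close> and \<open>j\<close> may take the value \<open>n\<close>, in accordance with the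
  hypothesis that \<open>a n = a 0\<close> (the case \<open>d = 0\<close> of the symmetry).\<close>
lemma circ_spectral:
  fixes a :: "nat \<Rightarrow> real"
  assumes n: "0 < n" and sym: "\<And>d. d \<le> n \<Longrightarrow> a (n - d) = a d" and ij: "i \<le> n" "j \<le> n"
  shows "(\<Sum>k<n. circ_eigenvalue n a k * (hartley n i k * hartley n j k))
           = real n * a (nat \<bar>int i - int j\<bar>)"
proof -
  let ?D = "int i - int j" and ?S = "int i + int j"
  have prod: "cos (root_angle n (int k * int d)) * (hartley n i k * hartley n j k)
     = (cos (root_angle n (int k * (int d - ?D))) + cos (root_angle n (int k * (int d + ?D)))) / 2
       + (sin (root_angle n (int k * (?S + int d))) + sin (root_angle n (int k * (?S - int d)))) / 2"
    (is "?l = ?r") for k d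
  proof -
    have *: "cos x * (cos y + sin z) = (cos (x - y) + cos (x + y)) / 2 + (sin (z + x) + sin (z - x)) / 2"
      for x y z :: real by (simp add: cos_diff cos_add sin_add sin_diff field_simps)
    show ?thesis unfolding hartley_mult *
      by (simp only: right_diff_distrib distrib_left root_angle_add root_angle_diff)
  qed
  have delta: "(\<Sum>d<n. a d * (if int n dvd int d - x then 1 else 0)) = a (nat (x mod int n))" for x
  proof -
    have "int n dvd int d - x \<longleftrightarrow> d = nat (x mod int n)" if "d < n" for d
      using that n by (auto simp: mod_eq_dvd_iff[symmetric] nat_eq_iff)
    then have "(\<Sum>d<n. a d * (if int n dvd int d - x then 1 else 0))
        = (\<Sum>d<n. if d = nat (x mod int n) then a d else 0)"
      by (intro sum.cong) auto
    also have "\<dots> = a (nat (x mod int n))" using n by (simp add: nat_less_iff)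
    finally show ?thesis .
  qed
  have md: "a (nat (x mod int n)) = a (nat \<bar>x\<bar>)" if x: "\<bar>x\<bar> \<le> int n" for x
  proof -
    consider "x = int n" | "0 \<le> x" "x < int n" | "x < 0" "- int n < x" | "x = - int n"
      using x by linarith
    then show ?thesis
    proof cases
      case 1 then show ?thesis using sym[of 0] by simp
    next
      case 2 then show ?thesis by simp
    next
      case 3
      have "x mod int n = (x + int n) mod int n" by simp
      also have "\<dots> = x + int n" using 3 by (intro mod_pos_pos_trivial) auto
      finally have "nat (x mod int n) = n - nat \<bar>x\<bar>" using 3 by linarith
      then show ?thesis using sym[of "nat \<bar>x\<bar>"] 3 by simp
    next
      case 4 then show ?thesis using sym[of 0] by simp
    qed
  qed
  have "(\<Sum>k<n. circ_eigenvalue n a k * (hartley n i k * hartley n j k))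
     = (\<Sum>k<n. \<Sum>d<n. a d * (cos (root_angle n (int k * int d)) * (hartley n i k * hartley n j k)))"
    by (simp add: circ_eigenvalue_def sum_distrib_right mult.assoc)
  also have "\<dots> = (\<Sum>d<n. a d * (\<Sum>k<n. cos (root_angle n (int k * int d)) * (hartley n i k * hartley n j k)))"
    by (subst sum.swap) (simp add: sum_distrib_left)
  also have "\<dots> = (\<Sum>d<n. a d * (((if int n dvd int d - ?D then real n else 0)
       + (if int n dvd int d + ?D then real n else 0)) / 2))"
    unfolding prod by (simp add: sum.distrib sum_cos_root_angle[OF n] sum_sin_root_angle[OF n]
      flip: sum_divide_distrib)
  also have "\<dots> = real n / 2 * ((\<Sum>d<n. a d * (if int n dvd int d - ?D then 1 else 0))
       + (\<Sum>d<n. a d * (if int n dvd int d - (- ?D) then 1 else 0)))"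
    unfolding sum.distrib[symmetric] sum_distrib_left by (intro sum.cong) (auto simp: algebra_simps)
  also have "\<dots> = real n / 2 * (a (nat \<bar>?D\<bar>) + a (nat \<bar>- ?D\<bar>))"
    unfolding delta using ij by (subst (1 2) md) auto
  also have "\<dots> = real n * a (nat \<bar>?D\<bar>)" by (simp only: abs_minus_cancel) simp
  finally show ?thesis .
qed

text \<open>Folding a sum over a period of odd length \<open>2 * h - 1\<close> along \<open>d \<mapsto> 2 * h - 1 - d\<close>.\<close>
lemma sum_reflect:
  fixes g :: "nat \<Rightarrow> real"
  assumes h: "0 < h" and g: "\<And>d. 0 < d \<Longrightarrow> d < h \<Longrightarrow> g (2 * h - 1 - d) = g d"
  shows "(\<Sum>d<2*h-1. g d) = g 0 + 2 * (\<Sum>d\<in>{1..<h}. g d)"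
proof -
  have "{..<2*h-1} = {0} \<union> {1..<h} \<union> {h..<2*h-1}" using h by auto
  then have "(\<Sum>d<2*h-1. g d) = g 0 + (\<Sum>d\<in>{1..<h}. g d) + (\<Sum>d\<in>{h..<2*h-1}. g d)"
    using h by (simp only:) (subst sum.union_disjoint; (subst sum.union_disjoint)?; auto)
  moreover have "(\<Sum>d\<in>{h..<2*h-1}. g d) = (\<Sum>d\<in>{1..<h}. g d)"
  proof (rule sum.reindex_bij_witness[of _ "\<lambda>d. 2*h-1-d" "\<lambda>d. 2*h-1-d"])
    fix d assume d: "d \<in> {h..<2*h-1}"
    show e: "2*h-1 - (2*h-1-d) = d" and "2*h-1-d \<in> {1..<h}" using d by auto
    show "g (2*h-1-d) = g d" using g[of "2*h-1-d"] d unfolding e by auto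
  qed auto
  ultimately show ?thesis by simp
qed

text \<open>The coefficient of \<open>b d\<close> in the \<open>k\<close>-th eigenvalue of the circulant block of size \<open>n\<close> of the palindromic
  Toeplitz matrix given by \<open>b\<close>. The values \<open>b d\<close> with \<open>d > 0\<close> occur twice in its first row.\<close>
definition eigen_coeff :: "nat \<Rightarrow> nat \<Rightarrow> nat \<Rightarrow> real" where
  "eigen_coeff n k d = (if d = 0 then 1 else 2 * cos (root_angle n (int k * int d)))"

lemma eigen_coeff_le: "\<bar>eigen_coeff n k d\<bar> \<le> 2"
  by (simp add: eigen_coeff_def abs_mult)

text \<open>The variance of an eigenvalue with \<open>k > 0\<close> is \<open>n - 1\<close>, where \<open>n = 2 * h - 1\<close>. Oddness of \<open>n\<close> is
  used: it ensures that \<open>n\<close> does not divide \<open>2 * k\<close>. For \<open>k = 0\<close> the variance is \<open>2 * n - 1\<close> instead.\<close>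
lemma sum_eigen_coeff_sq:
  assumes h: "0 < h" and k: "0 < k" "k < 2 * h - 1"
  shows "(\<Sum>d<h. (eigen_coeff (2 * h - 1) k d)\<^sup>2) = real (2 * h - 1) - 1"
proof -
  let ?n = "2 * h - 1"
  let ?c = "\<lambda>d. (cos (root_angle ?n (int k * int d)))\<^sup>2"
  have n: "0 < ?n" using h by simp
  have "\<not> int ?n dvd 2 * int k"
  proof
    assume "int ?n dvd 2 * int k"
    moreover have "coprime (int ?n) 2" using h by simp
    ultimately have "int ?n dvd int k" by (simp add: coprime_dvd_mult_right_iff)
    then show False using k by (auto dest!: zdvd_imp_le)
  qed
  then have "(\<Sum>d<?n. cos (root_angle ?n (int d * (2 * int k)))) = 0"
    using sum_cos_root_angle[OF n] by simp
  moreover have "?c d = 1 / 2 + cos (root_angle ?n (int d * (2 * int k))) / 2" for d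
  proof -
    have "root_angle ?n (int d * (2 * int k)) = 2 * root_angle ?n (int k * int d)"
      by (simp add: root_angle_def)
    then show ?thesis by (simp only: cos_double_cos) (simp add: field_simps)
  qed
  ultimately have 1: "(\<Sum>d<?n. ?c d) = real ?n / 2"
    by (simp add: sum.distrib flip: sum_divide_distrib)
  have 2: "(\<Sum>d<?n. ?c d) = ?c 0 + 2 * (\<Sum>d\<in>{1..<h}. ?c d)"
    using n by (intro sum_reflect[OF h] arg_cong[where f="\<lambda>x. x\<^sup>2"] cos_root_angle_reflect) auto
  have "{..<h} = insert 0 {1..<h}" using h by auto
  then have "(\<Sum>d<h. (eigen_coeff ?n k d)\<^sup>2) = 1 + (\<Sum>d\<in>{1..<h}. 4 * ?c d)"
    by (simp add: eigen_coeff_def power_mult_distrib)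
  also have "\<dots> = 1 + 4 * (\<Sum>d\<in>{1..<h}. ?c d)" by (simp add: sum_distrib_left)
  also have "\<dots> = real ?n - 1" using 1 2 by (simp add: root_angle_def)
  finally show ?thesis .
qed

lemma palindromic_toeplitz_index:
  assumes "N = 2 * h" "i < N" "j < N"
  shows "palindromic_toeplitz N b $$ (i, j) =
     (let d = nat \<bar>int i - int j\<bar> in if d < h then b d else b (N - 1 - d))"
  using assms by (auto simp: palindromic_toeplitz_def Let_def)

lemma palindromic_toeplitz_first_row:
  assumes "N = 2 * h" "i < N" "j < N"
  shows "palindromic_toeplitz N b $$ (i, j) = palindromic_toeplitz N b $$ (0, nat \<bar>int i - int j\<bar>)"
  using assms by (simp add: palindromic_toeplitz_index Let_def)

lemma palindromic_toeplitz_reflect: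
  assumes "0 < h" "d \<le> 2 * h - 1"
  shows "palindromic_toeplitz (2 * h) b $$ (0, 2 * h - 1 - d) = palindromic_toeplitz (2 * h) b $$ (0, d)"
proof -
  have "nat \<bar>int 0 - int x\<bar> = x" for x by simp
  then show ?thesis using assms
    by (subst (1 2) palindromic_toeplitz_index[of _ h]) (auto simp: Let_def simp del: of_nat_diff)
qed

text \<open>For a palindromic Toeplitz matrix \<open>A\<close> of size \<open>n + 1\<close>, the eigenvalues of its leading circulant
  block of size \<open>n\<close>, as functions of the first row of \<open>A\<close>. They are not eigenvalues of \<open>A\<close> itself.\<close>
definition pte_eigenvalue :: "nat \<Rightarrow> real mat \<Rightarrow> nat \<Rightarrow> real" where
  "pte_eigenvalue n A = circ_eigenvalue n (\<lambda>d. A $$ (0, d))"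

text \<open>The entry at \<open>(i, j)\<close> of a palindromic Toeplitz matrix of size \<open>2 * h\<close> is an even function of
  \<open>i - j\<close> modulo \<open>n = 2 * h - 1\<close>, so the spectral resolution of
  its circulant block extends to all \<open>n + 1\<close> rows and columns.\<close>
lemma pte_spectral:
  assumes h: "0 < h" and A: "A = palindromic_toeplitz (2 * h) b" and ij: "i < 2 * h" "j < 2 * h"
    and n: "n = 2 * h - 1"
  shows "A $$ (i, j) = (\<Sum>k<n. pte_eigenvalue n A k * (hartley n i k * hartley n j k)) / real n"
proof -
  have n0: "real n \<noteq> 0" using h n by simp
  have "(\<Sum>k<n. pte_eigenvalue n A k * (hartley n i k * hartley n j k))
     = real n * A $$ (0, nat \<bar>int i - int j\<bar>)"
    unfolding pte_eigenvalue_def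
  proof (rule circ_spectral)
    show "A $$ (0, n - d) = A $$ (0, d)" if "d \<le> n" for d
      unfolding A n using palindromic_toeplitz_reflect[OF h] that n by simp
  qed (use h ij n in linarith)+
  then show ?thesis
    using n0 palindromic_toeplitz_first_row[of "2*h" h i j b] ij by (simp add: A)
qed

lemma pte_eigenvalue_eq:
  assumes h: "0 < h" and A: "A = palindromic_toeplitz (2 * h) b" and n: "n = 2 * h - 1"
  shows "pte_eigenvalue n A k = (\<Sum>d<h. eigen_coeff n k d * b d)"
proof -
  have "pte_eigenvalue n A k = (\<Sum>d<2*h-1. A $$ (0, d) * cos (root_angle n (int k * int d)))"
    by (simp add: pte_eigenvalue_def circ_eigenvalue_def n)
  also have "\<dots> = A $$ (0, 0) * cos (root_angle n (int k * int 0))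
       + 2 * (\<Sum>d\<in>{1..<h}. A $$ (0, d) * cos (root_angle n (int k * int d)))"
  proof (rule sum_reflect[OF h])
    fix d assume "0 < d" "d < h"
    then have d: "d \<le> n" "0 < n" using n by auto
    show "A $$ (0, 2 * h - 1 - d) * cos (root_angle n (int k * int (2 * h - 1 - d)))
        = A $$ (0, d) * cos (root_angle n (int k * int d))"
      using palindromic_toeplitz_reflect[OF h, of d b] cos_root_angle_reflect[OF d(2,1), of k] d n
      by (simp only: A)
  qed
  also have "\<dots> = b 0 + (\<Sum>d\<in>{1..<h}. eigen_coeff n k d * b d)"
    using h by (auto simp: A sum_distrib_left palindromic_toeplitz_index eigen_coeff_def root_angle_def
        intro!: sum.cong)
  also have "\<dots> = (\<Sum>d\<in>insert 0 {1..<h}. eigen_coeff n k d * b d)"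
    by (simp add: eigen_coeff_def)
  also have "insert 0 {1..<h} = {..<h}" using h by auto
  finally show ?thesis .
qed

section \<open>Traces of nearly diagonal matrices\<close>

lemma mult_mat_index_sum:
  fixes X Y :: "real mat"
  assumes "X \<in> carrier_mat r s" "Y \<in> carrier_mat s t" "i < r" "j < t"
  shows "(X * Y) $$ (i, j) = (\<Sum>l<s. X $$ (i, l) * Y $$ (l, j))"
  using assms by (auto simp: scalar_prod_def lessThan_atLeast0 intro!: sum.cong)

lemma mat_trace_comm:
  assumes "X \<in> carrier_mat r s" "Y \<in> carrier_mat s r"
  shows "mat_trace (X * Y) = mat_trace (Y * X)"
proof -
  have "mat_trace (X * Y) = (\<Sum>i<r. \<Sum>j<s. X $$ (i, j) * Y $$ (j, i))"
    using assms by (auto simp: mat_trace_def mult_mat_index_sum[OF assms] simp del: index_mult_mat(1) intro!: sum.cong)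
  also have "\<dots> = (\<Sum>j<s. \<Sum>i<r. Y $$ (j, i) * X $$ (i, j))"
    by (subst sum.swap) (simp add: mult.commute)
  also have "\<dots> = mat_trace (Y * X)"
    using assms by (auto simp: mat_trace_def mult_mat_index_sum[OF assms(2,1)] simp del: index_mult_mat(1) intro!: sum.cong)
  finally show ?thesis .
qed

lemma pow_mat_Suc_rotate:
  fixes X Y :: "real mat"
  assumes "X \<in> carrier_mat r s" "Y \<in> carrier_mat s r"
  shows "(X * Y) ^\<^sub>m Suc p = X * ((Y * X) ^\<^sub>m p * Y)"
proof (induction p)
  case 0
  then show ?case using assms by simp
next
  case (Suc p)
  have P: "(Y * X) ^\<^sub>m p \<in> carrier_mat s s"
    using assms by (intro pow_carrier_mat) auto
  have "(X * Y) ^\<^sub>m Suc (Suc p) = X * ((Y * X) ^\<^sub>m p * Y) * (X * Y)"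
    using Suc by simp
  also have "\<dots> = X * ((Y * X) ^\<^sub>m p * Y * (X * Y))"
    using assms P by (intro assoc_mult_mat) auto
  also have "(Y * X) ^\<^sub>m p * Y * (X * Y) = (Y * X) ^\<^sub>m p * (Y * (X * Y))"
    using assms P by (intro assoc_mult_mat) auto
  also have "Y * (X * Y) = (Y * X) * Y"
    using assms by (intro assoc_mult_mat[symmetric]) auto
  also have "(Y * X) ^\<^sub>m p * (Y * X * Y) = (Y * X) ^\<^sub>m p * (Y * X) * Y"
    using assms P by (intro assoc_mult_mat[symmetric]) auto
  finally show ?case by simp
qed

lemma mat_trace_pow_rotate:
  fixes X Y :: "real mat"
  assumes X: "X \<in> carrier_mat r s" and Y: "Y \<in> carrier_mat s r" and "0 < p"
  shows "mat_trace ((X * Y) ^\<^sub>m p) = mat_trace ((Y * X) ^\<^sub>m p)"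
proof -
  obtain q where p: "p = Suc q" using \<open>0 < p\<close> by (cases p) auto
  have P: "(Y * X) ^\<^sub>m q \<in> carrier_mat s s"
    using assms by (intro pow_carrier_mat) auto
  have "mat_trace ((X * Y) ^\<^sub>m p) = mat_trace (X * ((Y * X) ^\<^sub>m q * Y))"
    unfolding p pow_mat_Suc_rotate[OF X Y] ..
  also have "\<dots> = mat_trace ((Y * X) ^\<^sub>m q * Y * X)"
    using X Y P by (intro mat_trace_comm) auto
  also have "(Y * X) ^\<^sub>m q * Y * X = (Y * X) ^\<^sub>m q * (Y * X)"
    using X Y P by (intro assoc_mult_mat) auto
  finally show ?thesis by (simp add: p)
qed

text \<open>\<open>X\<close> is a diagonal matrix with entries \<open>d\<close> of modulus at most \<open>\<alpha>\<close>, up to a perturbation whose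
  entries have modulus at most \<open>(\<gamma> - \<alpha>) / n\<close>. The perturbation size is encoded through \<open>\<gamma>\<close> because in this
  form both parameters are additive under sums and multiplicative under products.\<close>
definition near_diag :: "nat \<Rightarrow> (nat \<Rightarrow> real) \<Rightarrow> real \<Rightarrow> real \<Rightarrow> real mat \<Rightarrow> bool" where
  "near_diag n d \<alpha> \<gamma> X \<longleftrightarrow> X \<in> carrier_mat n n \<and> (\<forall>i<n. \<bar>d i\<bar> \<le> \<alpha>) \<and>
     (\<forall>i<n. \<forall>j<n. \<bar>X $$ (i, j) - (if i = j then d i else 0)\<bar> \<le> (\<gamma> - \<alpha>) / real n)"

lemma near_diagD:
  assumes "near_diag n d \<alpha> \<gamma> X"
  shows "X \<in> carrier_mat n n"
    and "i < n \<Longrightarrow> \<bar>d i\<bar> \<le> \<alpha>"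
    and "i < n \<Longrightarrow> j < n \<Longrightarrow> \<bar>X $$ (i, j) - (if i = j then d i else 0)\<bar> \<le> (\<gamma> - \<alpha>) / real n"
  using assms unfolding near_diag_def by blast+

lemma near_diag_add:
  assumes X: "near_diag n d \<alpha> \<gamma> X" and Y: "near_diag n e \<beta> \<delta> Y"
  shows "near_diag n (\<lambda>i. d i + e i) (\<alpha> + \<beta>) (\<gamma> + \<delta>) (X + Y)"
  unfolding near_diag_def
proof (intro conjI allI impI)
  show "X + Y \<in> carrier_mat n n" using near_diagD(1)[OF X] near_diagD(1)[OF Y] by simp
  fix i assume i: "i < n"
  show "\<bar>d i + e i\<bar> \<le> \<alpha> + \<beta>" using near_diagD(2)[OF X i] near_diagD(2)[OF Y i] by linarith
  fix j assume j: "j < n"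
  have "(X + Y) $$ (i, j) - (if i = j then d i + e i else 0)
     = (X $$ (i, j) - (if i = j then d i else 0)) + (Y $$ (i, j) - (if i = j then e i else 0))"
    using near_diagD(1)[OF X] near_diagD(1)[OF Y] i j by simp
  also have "\<bar>\<dots>\<bar> \<le> (\<gamma> - \<alpha>) / real n + (\<delta> - \<beta>) / real n"
    by (rule order_trans[OF abs_triangle_ineq add_mono[OF near_diagD(3)[OF X i j] near_diagD(3)[OF Y i j]]])
  also have "\<dots> = (\<gamma> + \<delta> - (\<alpha> + \<beta>)) / real n" by (simp add: algebra_simps flip: add_divide_distrib)
  finally show "\<bar>(X + Y) $$ (i, j) - (if i = j then d i + e i else 0)\<bar> \<le> (\<gamma> + \<delta> - (\<alpha> + \<beta>)) / real n" .
qed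

text \<open>With perturbations bounded by \<open>r = (\<gamma> - \<alpha>) / n\<close> and \<open>s = (\<delta> - \<beta>) / n\<close>, the product has
  perturbation at most \<open>\<alpha> * s + r * \<beta> + n * r * s = (\<gamma> * \<delta> - \<alpha> * \<beta>) / n\<close>.\<close>
lemma near_diag_mult:
  assumes X: "near_diag n d \<alpha> \<gamma> X" and Y: "near_diag n e \<beta> \<delta> Y"
  shows "near_diag n (\<lambda>i. d i * e i) (\<alpha> * \<beta>) (\<gamma> * \<delta>) (X * Y)"
proof -
  define R where "R i j = X $$ (i, j) - (if i = j then d i else 0)" for i j
  define S where "S i j = Y $$ (i, j) - (if i = j then e i else 0)" for i j
  define r where "r = (\<gamma> - \<alpha>) / real n"
  define s where "s = (\<delta> - \<beta>) / real n"
  note c = near_diagD(1)[OF X] near_diagD(1)[OF Y]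
  have d: "\<bar>d i\<bar> \<le> \<alpha>" "\<bar>e i\<bar> \<le> \<beta>" if "i < n" for i
    using near_diagD(2)[OF X that] near_diagD(2)[OF Y that] .
  have R: "\<bar>R i j\<bar> \<le> r" "\<bar>S i j\<bar> \<le> s" if "i < n" "j < n" for i j
    using near_diagD(3)[OF X that] near_diagD(3)[OF Y that] unfolding R_def S_def r_def s_def .
  show ?thesis unfolding near_diag_def
  proof (intro conjI allI impI)
    show "X * Y \<in> carrier_mat n n" using c by simp
    fix i assume i: "i < n"
    show "\<bar>d i * e i\<bar> \<le> \<alpha> * \<beta>" unfolding abs_mult
      using d[OF i] by (intro mult_mono) auto
    fix j assume j: "j < n"
    have "(X * Y) $$ (i, j) = (\<Sum>l<n. X $$ (i, l) * Y $$ (l, j))"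
      by (rule mult_mat_index_sum[OF c i j])
    also have "\<dots> = (\<Sum>l<n. (if l = i then d i * (if i = j then e i else 0) else 0)
         + (if l = i then d i * S i j else 0) + (if l = j then R i j * e j else 0) + R i l * S l j)"
      by (rule sum.cong) (auto simp: R_def S_def algebra_simps)
    also have "\<dots> = d i * (if i = j then e i else 0) + d i * S i j + R i j * e j + (\<Sum>l<n. R i l * S l j)"
      using i j by (simp add: sum.distrib)
    finally have "(X * Y) $$ (i, j) - (if i = j then d i * e i else 0)
       = d i * S i j + R i j * e j + (\<Sum>l<n. R i l * S l j)" by auto
    also have "\<bar>\<dots>\<bar> \<le> \<bar>d i * S i j\<bar> + \<bar>R i j * e j\<bar> + (\<Sum>l<n. \<bar>R i l * S l j\<bar>)"
      using sum_abs[of "\<lambda>l. R i l * S l j" "{..<n}"] by linarith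
    also have "\<dots> \<le> \<alpha> * s + r * \<beta> + (\<Sum>l<n. r * s)"
    proof (intro add_mono sum_mono)
      show "\<bar>d i * S i j\<bar> \<le> \<alpha> * s" "\<bar>R i j * e j\<bar> \<le> r * \<beta>"
        using d(1)[OF i] d(2)[OF j] R[OF i j] by (auto simp: abs_mult intro!: mult_mono)
      fix l assume "l \<in> {..<n}"
      then show "\<bar>R i l * S l j\<bar> \<le> r * s"
        using R(1)[OF i, of l] R(2)[OF _ j, of l] by (auto simp: abs_mult intro!: mult_mono)
    qed
    also have "\<dots> = (\<gamma> * \<delta> - \<alpha> * \<beta>) / real n"
      using i by (simp add: r_def s_def field_simps)
    finally show "\<bar>(X * Y) $$ (i, j) - (if i = j then d i * e i else 0)\<bar> \<le> (\<gamma> * \<delta> - \<alpha> * \<beta>) / real n" .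
  qed
qed

lemma near_diag_pow:
  assumes "near_diag n d \<alpha> \<gamma> X"
  shows "near_diag n (\<lambda>i. d i ^ p) (\<alpha> ^ p) (\<gamma> ^ p) (X ^\<^sub>m p)"
proof (induction p)
  case 0
  then show ?case using assms by (auto simp: near_diag_def)
next
  case (Suc p)
  then show ?case using near_diag_mult[OF Suc assms] by (simp add: mult.commute)
qed

lemma near_diag_trace:
  assumes X: "near_diag n d \<alpha> \<gamma> X" and n: "0 < n"
  shows "\<bar>mat_trace X - (\<Sum>i<n. d i)\<bar> \<le> \<gamma>"
proof -
  have "mat_trace X - (\<Sum>i<n. d i) = (\<Sum>i<n. X $$ (i, i) - d i)"
    using near_diagD(1)[OF X] by (auto simp: mat_trace_def sum_subtractf)
  also have "\<bar>\<dots>\<bar> \<le> (\<Sum>i<n. (\<gamma> - \<alpha>) / real n)"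
    by (intro order_trans[OF sum_abs] sum_mono) (use near_diagD(3)[OF X, of i i for i] in auto)
  also have "\<dots> \<le> \<gamma>" using n near_diagD(2)[OF X n] by simp
  finally show ?thesis .
qed

text \<open>Writing \<open>A = V D W\<close> with \<open>D\<close> diagonal and \<open>W V = G\<close> the identity plus \<open>1 / n\<close> times the all-ones
  matrix, the trace of a power of the anticommutator of \<open>A\<close> and \<open>B\<close> equals the trace of the same power
  of the \<open>n \<times> n\<close> matrix \<open>D G D' G + D' G D G\<close>, which is near-diagonal with diagonal \<open>2 * x k * y k\<close>.\<close>
lemma trace_anticommutator_pow:
  fixes U :: "nat \<Rightarrow> nat \<Rightarrow> real"
  assumes n: "0 < n" and p: "0 < p"
    and A: "A \<in> carrier_mat (Suc n) (Suc n)" and B: "B \<in> carrier_mat (Suc n) (Suc n)"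
    and gram: "\<And>k l. k < n \<Longrightarrow> l < n \<Longrightarrow>
       (\<Sum>i<Suc n. U i k * U i l) = (if k = l then real n else 0) + 1"
    and A_eq: "\<And>i j. i < Suc n \<Longrightarrow> j < Suc n \<Longrightarrow> A $$ (i, j) = (\<Sum>k<n. x k * (U i k * U j k)) / real n"
    and B_eq: "\<And>i j. i < Suc n \<Longrightarrow> j < Suc n \<Longrightarrow> B $$ (i, j) = (\<Sum>k<n. y k * (U i k * U j k)) / real n"
    and x: "\<And>k. k < n \<Longrightarrow> \<bar>x k\<bar> \<le> \<alpha>" and y: "\<And>k. k < n \<Longrightarrow> \<bar>y k\<bar> \<le> \<beta>"
  shows "\<bar>mat_trace (anticommutator A B ^\<^sub>m p) - (\<Sum>k<n. (2 * x k * y k) ^ p)\<bar> \<le> (8 * \<alpha> * \<beta>) ^ p"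
proof -
  define V where "V = mat (Suc n) n (\<lambda>(i, k). U i k)"
  define W where "W = mat n (Suc n) (\<lambda>(k, j). U j k / real n)"
  define D where "D z = mat n n (\<lambda>(k, l). if k = l then z k else 0 :: real)" for z
  define G where "G = W * V"
  have c: "V \<in> carrier_mat (Suc n) n" "W \<in> carrier_mat n (Suc n)" "D z \<in> carrier_mat n n"
    "G \<in> carrier_mat n n" for z
    by (auto simp: V_def W_def D_def G_def)
  have c': "D z * W \<in> carrier_mat n (Suc n)" "D z * G \<in> carrier_mat n n"
    "V * (D z * W) \<in> carrier_mat (Suc n) (Suc n)"
    "D z * G * (D z' * W) \<in> carrier_mat n (Suc n)" for z z'
    by (intro mult_carrier_mat[where n = n] c)+
  have fact: "C = V * (D z * W)"
    if C: "C \<in> carrier_mat (Suc n) (Suc n)"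
      and eq: "\<And>i j. i < Suc n \<Longrightarrow> j < Suc n \<Longrightarrow> C $$ (i, j) = (\<Sum>k<n. z k * (U i k * U j k)) / real n"
    for C z
  proof (rule eq_matI)
    fix i j assume "i < dim_row (V * (D z * W))" "j < dim_col (V * (D z * W))"
    then have ij: "i < Suc n" "j < Suc n" using c by (auto simp: V_def W_def)
    have DW: "(D z * W) $$ (k, j) = z k * (U j k / real n)" if k: "k < n" for k
    proof -
      have "(D z * W) $$ (k, j) = (\<Sum>l<n. (if k = l then z k else 0) * (U j l / real n))"
        unfolding mult_mat_index_sum[OF c(3,2) k ij(2)] using k ij by (simp add: D_def W_def)
      also have "\<dots> = (\<Sum>l<n. if l = k then z k * (U j k / real n) else 0)"
        by (rule sum.cong) auto
      also have "\<dots> = z k * (U j k / real n)" using k by simp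
      finally show ?thesis .
    qed
    have "(V * (D z * W)) $$ (i, j) = (\<Sum>k<n. V $$ (i, k) * (D z * W) $$ (k, j))"
      by (rule mult_mat_index_sum[OF c(1) mult_carrier_mat[OF c(3,2)] ij])
    also have "\<dots> = (\<Sum>k<n. z k * (U i k * U j k)) / real n"
      unfolding sum_divide_distrib using ij by (intro sum.cong) (auto simp: DW V_def)
    finally show "C $$ (i, j) = (V * (D z * W)) $$ (i, j)" using eq[OF ij] by simp
  qed (use C c in \<open>auto simp: V_def W_def\<close>)
  have G_index: "G $$ (k, l) = (if k = l then 1 else 0) + 1 / real n" if "k < n" "l < n" for k l
  proof -
    have "G $$ (k, l) = (\<Sum>i<Suc n. U i k * U i l) / real n"
      unfolding sum_divide_distrib G_def mult_mat_index_sum[OF c(2,1) that]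
      using that by (intro sum.cong) (auto simp: V_def W_def)
    then show ?thesis unfolding gram[OF that] using n by (simp add: add_divide_distrib)
  qed
  have near: "near_diag n z \<zeta> (2 * \<zeta>) (D z * G)" if z: "\<And>k. k < n \<Longrightarrow> \<bar>z k\<bar> \<le> \<zeta>" for z \<zeta>
    unfolding near_diag_def
  proof (intro conjI allI impI)
    show "D z * G \<in> carrier_mat n n" by (rule mult_carrier_mat[OF c(3,4)])
    fix k assume k: "k < n"
    show "\<bar>z k\<bar> \<le> \<zeta>" using z k .
    fix l assume l: "l < n"
    have "(D z * G) $$ (k, l) = (\<Sum>i<n. (if k = i then z k else 0) * G $$ (i, l))"
      unfolding mult_mat_index_sum[OF c(3,4) k l] using k by (simp add: D_def)
    also have "\<dots> = (\<Sum>i<n. if i = k then z k * G $$ (k, l) else 0)" by (rule sum.cong) auto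
    also have "\<dots> = z k * G $$ (k, l)" using k by simp
    finally have "(D z * G) $$ (k, l) - (if k = l then z k else 0) = z k / real n"
      using k l by (simp add: G_index algebra_simps)
    then show "\<bar>(D z * G) $$ (k, l) - (if k = l then z k else 0)\<bar> \<le> (2 * \<zeta> - \<zeta>) / real n"
      using z[OF k] by (simp add: divide_right_mono)
  qed
  define Y where "Y = D x * G * (D y * W) + D y * G * (D x * W)"
  have Yc: "Y \<in> carrier_mat n (Suc n)"
    unfolding Y_def by (intro add_carrier_mat c')
  have prod: "V * (D z * W) * (V * (D z' * W)) = V * (D z * G * (D z' * W))" for z z'
  proof -
    have "V * (D z * W) * (V * (D z' * W)) = V * ((D z * W) * (V * (D z' * W)))"
      by (rule assoc_mult_mat) (rule c c')+
    also have "(D z * W) * (V * (D z' * W)) = (D z * W * V) * (D z' * W)"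
      by (rule assoc_mult_mat[symmetric]) (rule c c')+
    also have "D z * W * V = D z * G"
      unfolding G_def by (rule assoc_mult_mat) (rule c c')+
    finally show ?thesis .
  qed
  have A_fact: "A = V * (D x * W)" by (rule fact[OF A]) (rule A_eq)
  have B_fact: "B = V * (D y * W)" by (rule fact[OF B]) (rule B_eq)
  have "anticommutator A B = V * Y"
    unfolding anticommutator_def A_fact B_fact prod Y_def
    by (rule mult_add_distrib_mat[symmetric]) (rule c c')+
  moreover have "Y * V = D x * G * (D y * G) + D y * G * (D x * G)"
  proof -
    have "Y * V = D x * G * (D y * W) * V + D y * G * (D x * W) * V"
      unfolding Y_def by (rule add_mult_distrib_mat) (rule c c')+
    moreover have "D z * G * (D z' * W) * V = D z * G * (D z' * G)" for z z'
    proof -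
      have "D z * G * (D z' * W) * V = D z * G * (D z' * W * V)"
        by (rule assoc_mult_mat) (rule c c')+
      also have "D z' * W * V = D z' * G"
        unfolding G_def by (rule assoc_mult_mat) (rule c c')+
      finally show ?thesis .
    qed
    ultimately show ?thesis by simp
  qed
  ultimately have tr: "mat_trace (anticommutator A B ^\<^sub>m p)
      = mat_trace ((D x * G * (D y * G) + D y * G * (D x * G)) ^\<^sub>m p)"
    using mat_trace_pow_rotate[OF c(1) Yc p] by simp
  have "near_diag n (\<lambda>k. x k * y k + y k * x k) (\<alpha> * \<beta> + \<beta> * \<alpha>)
      (2 * \<alpha> * (2 * \<beta>) + 2 * \<beta> * (2 * \<alpha>)) (D x * G * (D y * G) + D y * G * (D x * G))"
    using x y by (intro near_diag_add near_diag_mult near) auto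
  from near_diag_trace[OF near_diag_pow[OF this, of p] n]
  show ?thesis unfolding tr by (simp add: mult_ac)
qed

section \<open>The expected trace\<close>

lemma standardized_law_moments:
  assumes "standardized_law \<mu>"
  shows "(\<integral>x. x ^ 0 \<partial>\<mu>) = 1" "(\<integral>x. x ^ 1 \<partial>\<mu>) = 0" "(\<integral>x. x ^ 2 \<partial>\<mu>) = 1"
    and "integrable \<mu> (\<lambda>x. x ^ q)"
  using assms prob_space.prob_space[of \<mu>] by (auto simp: standardized_law_def)

lemma (in prob_space) pte_eigenvalue_moments:
  assumes mu: "standardized_law \<mu>" and A: "sampled_from_PTE M \<mu> (2 * h) A" and h: "0 < h"
    and n: "n = 2 * h - 1"
  shows "integrable M (\<lambda>\<omega>. pte_eigenvalue n (A \<omega>) k ^ p)"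
    and "expectation (\<lambda>\<omega>. pte_eigenvalue n (A \<omega>) k ^ p)
           = wsum_moment (\<lambda>q. \<integral>x. x ^ q \<partial>\<mu>) (eigen_coeff n k) h p"
proof -
  obtain b where b: "indep_vars (\<lambda>_. borel) b {..<h}" "\<And>k. k < h \<Longrightarrow> distr M borel (b k) = \<mu>"
    "\<And>\<omega>. \<omega> \<in> space M \<Longrightarrow> A \<omega> = palindromic_toeplitz (2 * h) (\<lambda>k. b k \<omega>)"
    using A by (auto simp: sampled_from_PTE_def)
  have eq: "pte_eigenvalue n (A \<omega>) k ^ p = (\<Sum>d<h. eigen_coeff n k d * b d \<omega>) ^ p"
    if "\<omega> \<in> space M" for \<omega>
    using pte_eigenvalue_eq[OF h b(3)[OF that] n] by simp
  note * = weighted_sum_moments[OF b(1,2) standardized_law_moments(4)[OF mu] order_refl, of "eigen_coeff n k" p]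
  show "integrable M (\<lambda>\<omega>. pte_eigenvalue n (A \<omega>) k ^ p)"
    using * by (subst Bochner_Integration.integrable_cong[OF refl eq]) auto
  show "expectation (\<lambda>\<omega>. pte_eigenvalue n (A \<omega>) k ^ p)
           = wsum_moment (\<lambda>q. \<integral>x. x ^ q \<partial>\<mu>) (eigen_coeff n k) h p"
    using * by (subst Bochner_Integration.integral_cong[OF refl eq]) auto
qed

lemma exists_max_abs:
  fixes x :: "nat \<Rightarrow> real"
  assumes "0 < n"
  obtains k where "k < n" "\<And>i. i < n \<Longrightarrow> \<bar>x i\<bar> \<le> \<bar>x k\<bar>"
proof -
  let ?S = "(\<lambda>i. \<bar>x i\<bar>) ` {..<n}"
  have "Max ?S \<in> ?S" using assms by (intro Max_in) auto
  then obtain k where "k < n" "Max ?S = \<bar>x k\<bar>" by auto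
  then show ?thesis using that Max_ge[of ?S] by force
qed

lemma le_add_fourth_power:
  fixes u s :: real
  assumes "0 \<le> u" "0 < s"
  shows "u \<le> s + u ^ 4 / s ^ 3"
proof (cases "u \<le> s")
  case True
  have "0 \<le> u ^ 4 / s ^ 3" using assms by simp
  then show ?thesis using True by linarith
next
  case False
  then have "s ^ 3 * u \<le> u ^ 3 * u" using assms by (intro mult_right_mono power_mono) auto
  then have "u \<le> u ^ 4 / s ^ 3" using assms by (simp add: field_simps eval_nat_numeral)
  then show ?thesis using assms by linarith
qed

text \<open>The largest eigenvalues are controlled without any bound on maxima of random variables: a power
  \<open>u\<close> of their product is at most \<open>s + u ^ 4 / s ^ 3\<close>, and \<open>u ^ 4\<close> is one summand of the double sum.
  The free parameter \<open>s\<close> is chosen in the limit argument.\<close>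
lemma pte_trace_bound:
  assumes h: "0 < h" and n: "n = 2 * h - 1" and m: "0 < m" and s: "0 < s"
    and A: "A = palindromic_toeplitz (2 * h) a" and B: "B = palindromic_toeplitz (2 * h) b"
  defines "x \<equiv> pte_eigenvalue n A" and "y \<equiv> pte_eigenvalue n B"
  shows "\<bar>mat_trace (anticommutator A B ^\<^sub>m (2 * m)) - 4 ^ m * (\<Sum>k<n. x k ^ (2 * m) * y k ^ (2 * m))\<bar>
     \<le> 64 ^ m * (s + (\<Sum>k<n. \<Sum>l<n. x k ^ (8 * m) * y l ^ (8 * m)) / s ^ 3)"
proof -
  have n0: "0 < n" and N: "Suc n = 2 * h" using h n by auto
  obtain k where k: "k < n" "\<And>i. i < n \<Longrightarrow> \<bar>x i\<bar> \<le> \<bar>x k\<bar>" 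
    using exists_max_abs[OF n0, of x] by blast
  obtain l where l: "l < n" "\<And>i. i < n \<Longrightarrow> \<bar>y i\<bar> \<le> \<bar>y l\<bar>" 
    using exists_max_abs[OF n0, of y] by blast
  let ?u = "(\<bar>x k\<bar> * \<bar>y l\<bar>) ^ (2 * m)"
  have carr: "A \<in> carrier_mat (Suc n) (Suc n)" "B \<in> carrier_mat (Suc n) (Suc n)"
    by (auto simp: A B N palindromic_toeplitz_def)
  have "\<bar>mat_trace (anticommutator A B ^\<^sub>m (2 * m)) - (\<Sum>k<n. (2 * x k * y k) ^ (2 * m))\<bar>
      \<le> (8 * \<bar>x k\<bar> * \<bar>y l\<bar>) ^ (2 * m)"
  proof (rule trace_anticommutator_pow[where U = "hartley n"])
    show "A $$ (i, j) = (\<Sum>k<n. x k * (hartley n i k * hartley n j k)) / real n"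
      if "i < Suc n" "j < Suc n" for i j
      unfolding x_def using pte_spectral[OF h A _ _ n] that N by simp
    show "B $$ (i, j) = (\<Sum>k<n. y k * (hartley n i k * hartley n j k)) / real n"
      if "i < Suc n" "j < Suc n" for i j
      unfolding y_def using pte_spectral[OF h B _ _ n] that N by simp
  qed (use n0 m carr hartley_gram k l in auto)
  also have "(8 * \<bar>x k\<bar> * \<bar>y l\<bar>) ^ (2 * m) = 64 ^ m * ?u"
    by (simp add: power_mult_distrib power_mult)
  also have "\<dots> \<le> 64 ^ m * (s + ?u ^ 4 / s ^ 3)"
    using s by (intro mult_left_mono le_add_fourth_power) auto
  also have "?u ^ 4 = x k ^ (8 * m) * y l ^ (8 * m)"
  proof -
    have "?u ^ 4 = \<bar>x k * y l\<bar> ^ (8 * m)" by (simp add: abs_mult flip: power_mult)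
    also have "\<dots> = (x k * y l) ^ (8 * m)" by (rule power_even_abs) simp
    finally show ?thesis by (simp add: power_mult_distrib)
  qed
  also have "64 ^ m * (s + x k ^ (8 * m) * y l ^ (8 * m) / s ^ 3)
     \<le> 64 ^ m * (s + (\<Sum>k<n. \<Sum>l<n. x k ^ (8 * m) * y l ^ (8 * m)) / s ^ 3)"
  proof -
    have nn: "0 \<le> x k ^ (8 * m) * y l ^ (8 * m)" for k l by (simp add: zero_le_even_power)
    have "x k ^ (8 * m) * y l ^ (8 * m) \<le> (\<Sum>l<n. x k ^ (8 * m) * y l ^ (8 * m))"
      using l by (intro member_le_sum nn) auto
    also have "\<dots> \<le> (\<Sum>k<n. \<Sum>l<n. x k ^ (8 * m) * y l ^ (8 * m))"
      using k by (intro member_le_sum[of k _ "\<lambda>k. \<Sum>l<n. x k ^ (8 * m) * y l ^ (8 * m)"] sum_nonneg nn) auto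
    finally show ?thesis using s by (intro mult_left_mono add_left_mono divide_right_mono) auto
  qed
  finally have "\<bar>mat_trace (anticommutator A B ^\<^sub>m (2 * m)) - (\<Sum>k<n. (2 * x k * y k) ^ (2 * m))\<bar>
     \<le> 64 ^ m * (s + (\<Sum>k<n. \<Sum>l<n. x k ^ (8 * m) * y l ^ (8 * m)) / s ^ 3)" .
  moreover have "(\<Sum>k<n. (2 * x k * y k) ^ (2 * m)) = 4 ^ m * (\<Sum>k<n. x k ^ (2 * m) * y k ^ (2 * m))"
    by (simp add: power_mult_distrib power_mult sum_distrib_left mult.assoc)
  ultimately show ?thesis by simp
qed

text \<open>\<open>X\<close> is a random \<open>N \<times> N\<close> matrix in the sense that all its entries are measurable.\<close>
definition measurable_entries :: "'w measure \<Rightarrow> nat \<Rightarrow> ('w \<Rightarrow> real mat) \<Rightarrow> bool" where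
  "measurable_entries M N X \<longleftrightarrow> (\<forall>\<omega>\<in>space M. X \<omega> \<in> carrier_mat N N) \<and>
     (\<forall>i<N. \<forall>j<N. (\<lambda>\<omega>. X \<omega> $$ (i, j)) \<in> borel_measurable M)"

lemma measurable_entries_cong:
  assumes X: "\<And>\<omega>. \<omega> \<in> space M \<Longrightarrow> X \<omega> \<in> carrier_mat N N"
    and eq: "\<And>\<omega> i j. \<omega> \<in> space M \<Longrightarrow> i < N \<Longrightarrow> j < N \<Longrightarrow> X \<omega> $$ (i, j) = f i j \<omega>"
    and f: "\<And>i j. i < N \<Longrightarrow> j < N \<Longrightarrow> f i j \<in> borel_measurable M"
  shows "measurable_entries M N X"
  unfolding measurable_entries_def
proof (intro conjI ballI allI impI)
  fix i j assume ij: "i < N" "j < N"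
  show "(\<lambda>\<omega>. X \<omega> $$ (i, j)) \<in> borel_measurable M"
    using f[OF ij] eq ij by (subst measurable_cong[where g="f i j"]) auto
qed (rule X)

lemma measurable_entries_mult:
  assumes X: "measurable_entries M N X" and Y: "measurable_entries M N Y"
  shows "measurable_entries M N (\<lambda>\<omega>. X \<omega> * Y \<omega>)"
proof (rule measurable_entries_cong)
  show "X \<omega> * Y \<omega> \<in> carrier_mat N N" if "\<omega> \<in> space M" for \<omega>
    using X Y that by (auto simp: measurable_entries_def)
  show "(X \<omega> * Y \<omega>) $$ (i, j) = (\<Sum>l<N. X \<omega> $$ (i, l) * Y \<omega> $$ (l, j))"
    if "\<omega> \<in> space M" "i < N" "j < N" for \<omega> i j
    by (rule mult_mat_index_sum) (use X Y that in \<open>auto simp: measurable_entries_def\<close>)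
  show "(\<lambda>\<omega>. \<Sum>l<N. X \<omega> $$ (i, l) * Y \<omega> $$ (l, j)) \<in> borel_measurable M" if "i < N" "j < N" for i j
    using X Y that by (intro borel_measurable_sum borel_measurable_times) (auto simp: measurable_entries_def)
qed

lemma measurable_entries_add:
  assumes X: "measurable_entries M N X" and Y: "measurable_entries M N Y"
  shows "measurable_entries M N (\<lambda>\<omega>. X \<omega> + Y \<omega>)"
proof (rule measurable_entries_cong)
  show "X \<omega> + Y \<omega> \<in> carrier_mat N N" if "\<omega> \<in> space M" for \<omega>
    using X Y that by (auto simp: measurable_entries_def)
  show "(X \<omega> + Y \<omega>) $$ (i, j) = X \<omega> $$ (i, j) + Y \<omega> $$ (i, j)"
    if "\<omega> \<in> space M" "i < N" "j < N" for \<omega> i j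
    using Y that by (auto simp: measurable_entries_def)
  show "(\<lambda>\<omega>. X \<omega> $$ (i, j) + Y \<omega> $$ (i, j)) \<in> borel_measurable M" if "i < N" "j < N" for i j
    using X Y that by (intro borel_measurable_add) (auto simp: measurable_entries_def)
qed

lemma measurable_entries_pow:
  assumes X: "measurable_entries M N X"
  shows "measurable_entries M N (\<lambda>\<omega>. X \<omega> ^\<^sub>m p)"
proof (induction p)
  case 0
  show ?case
    by (rule measurable_entries_cong[where f="\<lambda>i j _. if i = j then 1 else 0"])
      (use X in \<open>auto simp: measurable_entries_def\<close>)
next
  case (Suc p)
  then show ?case using measurable_entries_mult[OF Suc X] by simp
qed

lemma measurable_mat_trace:
  assumes X: "measurable_entries M N X"
  shows "(\<lambda>\<omega>. mat_trace (X \<omega>)) \<in> borel_measurable M"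
proof -
  have "(\<lambda>\<omega>. mat_trace (X \<omega>)) \<in> borel_measurable M
      \<longleftrightarrow> (\<lambda>\<omega>. \<Sum>i<N. X \<omega> $$ (i, i)) \<in> borel_measurable M"
    by (rule measurable_cong) (use X in \<open>auto simp: measurable_entries_def mat_trace_def\<close>)
  moreover have "(\<lambda>\<omega>. \<Sum>i<N. X \<omega> $$ (i, i)) \<in> borel_measurable M"
    by (rule borel_measurable_sum) (use X in \<open>auto simp: measurable_entries_def\<close>)
  ultimately show ?thesis by blast
qed

lemma entry_family_index: "i < N \<Longrightarrow> j < N \<Longrightarrow> entry_family N A (i, j) = A $$ (i, j)"
  by (simp add: entry_family_def)

context prob_space
begin

lemma measurable_entries_of_family:
  assumes fam: "(\<lambda>\<omega>. entry_family N (A \<omega>)) \<in> measurable M (\<Pi>\<^sub>M p\<in>{..<N} \<times> {..<N}. borel)"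
    and A: "\<And>\<omega>. \<omega> \<in> space M \<Longrightarrow> A \<omega> \<in> carrier_mat N N"
  shows "measurable_entries M N A"
proof (rule measurable_entries_cong[OF A])
  show "A \<omega> $$ (i, j) = entry_family N (A \<omega>) (i, j)" if "i < N" "j < N" for \<omega> i j
    using that by (simp add: entry_family_index)
  show "(\<lambda>\<omega>. entry_family N (A \<omega>) (i, j)) \<in> borel_measurable M" if "i < N" "j < N" for i j
    by (rule measurable_compose[OF fam measurable_component_singleton]) (use that in auto)
qed

lemma indep_pte_eigenvalues:
  assumes ind: "independent_matrices M N A B" and n: "n < N"
  shows "indep_var borel (\<lambda>\<omega>. pte_eigenvalue n (A \<omega>) k ^ p) borel (\<lambda>\<omega>. pte_eigenvalue n (B \<omega>) l ^ q)"
proof -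
  define Y where "Y k p e = (\<Sum>d<n. e (0, d) * cos (root_angle n (int k * int d))) ^ p"
    for k p :: nat and e :: "nat \<times> nat \<Rightarrow> real"
  have Y: "Y k p \<in> borel_measurable (\<Pi>\<^sub>M p\<in>{..<N} \<times> {..<N}. borel)" for k p
    unfolding Y_def using n
    by (intro borel_measurable_power borel_measurable_sum borel_measurable_times
        measurable_component_singleton) auto
  have eq: "Y k p \<circ> (\<lambda>\<omega>. entry_family N (C \<omega>)) = (\<lambda>\<omega>. pte_eigenvalue n (C \<omega>) k ^ p)"
    for k p and C :: "'a \<Rightarrow> real mat"
    using n by (auto simp: fun_eq_iff Y_def pte_eigenvalue_def circ_eigenvalue_def entry_family_index)
  show ?thesis
    using indep_var_compose[OF ind[unfolded independent_matrices_def] Y Y, of k p l q]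
    by (simp only: eq)
qed

text \<open>Since the two matrices are independent, expectations of products of eigenvalue powers factor
  into the moments \<open>x\<close> and \<open>y\<close>.\<close>
lemma pte_expected_trace_bound:
  assumes mu: "standardized_law \<mu>" and nu: "standardized_law \<nu>"
    and A: "sampled_from_PTE M \<mu> (2 * h) A" and B: "sampled_from_PTE M \<nu> (2 * h) B"
    and ind: "independent_matrices M (2 * h) A B"
    and h: "0 < h" and m: "0 < m" and s: "0 < s" and n: "n = 2 * h - 1"
  defines "x \<equiv> \<lambda>k. wsum_moment (\<lambda>q. \<integral>x. x ^ q \<partial>\<mu>) (eigen_coeff n k) h"
    and "y \<equiv> \<lambda>k. wsum_moment (\<lambda>q. \<integral>x. x ^ q \<partial>\<nu>) (eigen_coeff n k) h"
  shows "\<bar>expectation (\<lambda>\<omega>. mat_trace (anticommutator (A \<omega>) (B \<omega>) ^\<^sub>m (2 * m)))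
       - 4 ^ m * (\<Sum>k<n. x k (2 * m) * y k (2 * m))\<bar>
     \<le> 64 ^ m * (s + (\<Sum>k<n. \<Sum>l<n. x k (8 * m) * y l (8 * m)) / s ^ 3)"
proof -
  let ?T = "\<lambda>\<omega>. mat_trace (anticommutator (A \<omega>) (B \<omega>) ^\<^sub>m (2 * m))"
  let ?X = "\<lambda>k \<omega>. pte_eigenvalue n (A \<omega>) k" and ?Y = "\<lambda>k \<omega>. pte_eigenvalue n (B \<omega>) k"
  let ?D = "\<lambda>\<omega>. 4 ^ m * (\<Sum>k<n. ?X k \<omega> ^ (2 * m) * ?Y k \<omega> ^ (2 * m))"
  let ?R = "\<lambda>\<omega>. 64 ^ m * (s + (\<Sum>k<n. \<Sum>l<n. ?X k \<omega> ^ (8 * m) * ?Y l \<omega> ^ (8 * m)) / s ^ 3)"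
  obtain a where a: "\<And>\<omega>. \<omega> \<in> space M \<Longrightarrow> A \<omega> = palindromic_toeplitz (2 * h) (\<lambda>k. a k \<omega>)"
    using A by (auto simp: sampled_from_PTE_def)
  obtain b where b: "\<And>\<omega>. \<omega> \<in> space M \<Longrightarrow> B \<omega> = palindromic_toeplitz (2 * h) (\<lambda>k. b k \<omega>)"
    using B by (auto simp: sampled_from_PTE_def)
  have nN: "n < 2 * h" using n h by simp
  note iv = indep_pte_eigenvalues[OF ind nN]
  note mA = pte_eigenvalue_moments[OF mu A h n] and mB = pte_eigenvalue_moments[OF nu B h n]
  have int: "integrable M (\<lambda>\<omega>. ?X k \<omega> ^ p * ?Y l \<omega> ^ q)" for k l p q
    by (rule indep_var_integrable[OF iv mA(1) mB(1)])
  have ex: "expectation (\<lambda>\<omega>. ?X k \<omega> ^ p * ?Y l \<omega> ^ q) = x k p * y l q" for k l p q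
    using indep_var_lebesgue_integral[OF iv mA(1) mB(1), of k p l q]
    by (simp add: mA(2) mB(2) x_def y_def)
  have D: "integrable M ?D" by (intro integrable_mult_right Bochner_Integration.integrable_sum int)
  have R: "integrable M ?R"
    by (intro integrable_mult_right Bochner_Integration.integrable_add integrable_const
        integrable_divide_zero Bochner_Integration.integrable_sum int)
  have bound: "\<bar>?T \<omega> - ?D \<omega>\<bar> \<le> ?R \<omega>" if "\<omega> \<in> space M" for \<omega>
    by (rule pte_trace_bound[OF h n m s a[OF that] b[OF that]])
  have rv: "(\<lambda>\<omega>. entry_family (2 * h) (A \<omega>)) \<in> measurable M (\<Pi>\<^sub>M p\<in>{..<2*h} \<times> {..<2*h}. borel)"
    "(\<lambda>\<omega>. entry_family (2 * h) (B \<omega>)) \<in> measurable M (\<Pi>\<^sub>M p\<in>{..<2*h} \<times> {..<2*h}. borel)"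
    using ind indep_var_rv1 indep_var_rv2 unfolding independent_matrices_def by blast+
  have "measurable_entries M (2 * h) A" "measurable_entries M (2 * h) B"
    using rv a b by (auto intro!: measurable_entries_of_family simp: palindromic_toeplitz_def)
  then have T: "?T \<in> borel_measurable M"
    unfolding anticommutator_def
    by (intro measurable_mat_trace measurable_entries_pow measurable_entries_add measurable_entries_mult)
  have TD: "integrable M (\<lambda>\<omega>. ?T \<omega> - ?D \<omega>)"
  proof (rule Bochner_Integration.integrable_bound[OF R])
    show "(\<lambda>\<omega>. ?T \<omega> - ?D \<omega>) \<in> borel_measurable M"
      using T D by (intro borel_measurable_diff) auto
    show "AE \<omega> in M. norm (?T \<omega> - ?D \<omega>) \<le> norm (?R \<omega>)"
      using bound by (intro AE_I2) (smt (verit) real_norm_def)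
  qed
  have "integrable M (\<lambda>\<omega>. (?T \<omega> - ?D \<omega>) + ?D \<omega>)" by (rule Bochner_Integration.integrable_add[OF TD D])
  then have T_int: "integrable M ?T" by simp
  have "\<bar>expectation ?T - expectation ?D\<bar> = \<bar>expectation (\<lambda>\<omega>. ?T \<omega> - ?D \<omega>)\<bar>"
    by (simp add: Bochner_Integration.integral_diff[OF T_int D])
  also have "\<dots> \<le> expectation (\<lambda>\<omega>. \<bar>?T \<omega> - ?D \<omega>\<bar>)" by (rule integral_abs_bound)
  also have "\<dots> \<le> expectation ?R"
    by (rule integral_mono[OF _ R bound]) (use TD in simp)
  also have "expectation ?R = 64 ^ m * (s + (\<Sum>k<n. \<Sum>l<n. x k (8 * m) * y l (8 * m)) / s ^ 3)"
    by (simp add: int ex prob_space)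
  also have "expectation ?D = 4 ^ m * (\<Sum>k<n. x k (2 * m) * y k (2 * m))"
    by (simp add: int ex)
  finally show ?thesis .
qed

end

section \<open>The limit\<close>

lemma abs_prod_diff_le:
  fixes a b G :: real
  assumes "\<bar>a - G\<bar> \<le> e" "\<bar>b - G\<bar> \<le> f" "\<bar>b\<bar> \<le> \<beta>" "\<bar>G\<bar> \<le> \<gamma>"
  shows "\<bar>a * b - G\<^sup>2\<bar> \<le> e * \<beta> + \<gamma> * f"
proof -
  have "a * b - G\<^sup>2 = (a - G) * b + G * (b - G)" by (simp add: algebra_simps power2_eq_square)
  also have "\<bar>\<dots>\<bar> \<le> \<bar>(a - G) * b\<bar> + \<bar>G * (b - G)\<bar>" by (rule abs_triangle_ineq)
  also have "\<dots> \<le> e * \<beta> + \<gamma> * f"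
    unfolding abs_mult using assms by (intro add_mono mult_mono) auto
  finally show ?thesis .
qed

text \<open>Every \<open>k > 0\<close> contributes the square of the normal moment of variance \<open>n - 1\<close> up to lower order;
  \<open>k = 0\<close>, where the variance is different, contributes one term of order \<open>h ^ (2 * m)\<close> only.\<close>
lemma sum_eigen_moments_approx:
  fixes M M' :: "nat \<Rightarrow> real"
  assumes M: "M 0 = 1" "M 1 = 0" "M 2 = 1" and M': "M' 0 = 1" "M' 1 = 0" "M' 2 = 1" and m: "0 < m"
  shows "\<exists>C\<ge>0. \<forall>h n. 0 < h \<longrightarrow> n = 2 * h - 1 \<longrightarrow>
    \<bar>(\<Sum>k<n. wsum_moment M (eigen_coeff n k) h (2 * m) * wsum_moment M' (eigen_coeff n k) h (2 * m))
       - real n * (gauss_moment (2 * m) * (real n - 1) ^ m)\<^sup>2\<bar> \<le> C * real (Suc h) ^ (2 * m)"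
proof -
  let ?g = "gauss_moment (2 * m)"
  have e: "(2 * m - 1) div 2 = m - 1" "2 * m div 2 = m" using m by auto
  obtain K where K: "0 \<le> K" "\<And>c n. (\<forall>i<n. \<bar>c i\<bar> \<le> 2) \<Longrightarrow>
     \<bar>wsum_moment M c n (2 * m) - ?g * (\<Sum>i<n. (c i)\<^sup>2) ^ m\<bar> \<le> K * real (Suc n) ^ (m - 1)"
    using wsum_moment_approx[of M "2 * m"] M unfolding e by blast
  obtain K' where K': "0 \<le> K'" "\<And>c n. (\<forall>i<n. \<bar>c i\<bar> \<le> 2) \<Longrightarrow>
     \<bar>wsum_moment M' c n (2 * m) - ?g * (\<Sum>i<n. (c i)\<^sup>2) ^ m\<bar> \<le> K' * real (Suc n) ^ (m - 1)"
    using wsum_moment_approx[of M' "2 * m"] M' unfolding e by blast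
  obtain L where L: "0 \<le> L" "\<And>c n. (\<forall>i<n. \<bar>c i\<bar> \<le> 2) \<Longrightarrow>
     \<bar>wsum_moment M c n (2 * m)\<bar> \<le> L * real (Suc n) ^ m"
    using wsum_moment_bound[of M "2 * m"] M unfolding e by blast
  obtain L' where L': "0 \<le> L'" "\<And>c n. (\<forall>i<n. \<bar>c i\<bar> \<le> 2) \<Longrightarrow>
     \<bar>wsum_moment M' c n (2 * m)\<bar> \<le> L' * real (Suc n) ^ m"
    using wsum_moment_bound[of M' "2 * m"] M' unfolding e by blast
  define \<gamma> where "\<gamma> = ?g * 2 ^ m"
  define D where "D = L * L' + \<gamma>\<^sup>2"
  define E where "E = K * L' + \<gamma> * K'"
  have g0: "0 \<le> \<gamma>" unfolding \<gamma>_def using gauss_moment_nonneg by simp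
  have D0: "0 \<le> D" and E0: "0 \<le> E" using K(1) K'(1) L(1) L'(1) g0 by (auto simp: D_def E_def)
  have main: "\<bar>(\<Sum>k<n. wsum_moment M (eigen_coeff n k) h (2 * m) * wsum_moment M' (eigen_coeff n k) h (2 * m))
       - real n * (?g * (real n - 1) ^ m)\<^sup>2\<bar> \<le> (D + 2 * E) * real (Suc h) ^ (2 * m)"
    if h: "0 < h" and n: "n = 2 * h - 1" for h n
  proof -
    define S where "S = real (Suc h)"
    define G where "G = ?g * (real n - 1) ^ m"
    let ?x = "\<lambda>k. wsum_moment M (eigen_coeff n k) h (2 * m)"
    let ?y = "\<lambda>k. wsum_moment M' (eigen_coeff n k) h (2 * m)"
    have n0: "0 < n" using h n by simp
    have S: "1 \<le> S" "real n - 1 \<le> 2 * S" "0 \<le> real n - 1" "real n \<le> 2 * S"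
      using h n by (auto simp: S_def)
    have c: "\<forall>i<h. \<bar>eigen_coeff n k i\<bar> \<le> 2" for k by (simp add: eigen_coeff_le)
    have G: "0 \<le> G" "G \<le> \<gamma> * S ^ m"
    proof -
      show "0 \<le> G" unfolding G_def using S gauss_moment_nonneg by simp
      have "G \<le> ?g * (2 * S) ^ m"
        unfolding G_def using S gauss_moment_nonneg by (intro mult_left_mono power_mono) auto
      then show "G \<le> \<gamma> * S ^ m" by (simp add: \<gamma>_def power_mult_distrib mult.assoc)
    qed
    have Sm: "S ^ (m - 1) * S ^ m = S ^ (2 * m - 1)" "S ^ m * S ^ m = S ^ (2 * m)"
      "S * S ^ (2 * m - 1) = S ^ (2 * m)"
      using m by (auto simp: mult_2 simp flip: power_add power_Suc)
    have x: "\<bar>?x k\<bar> \<le> L * S ^ m" and y: "\<bar>?y k\<bar> \<le> L' * S ^ m" for k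
      unfolding S_def by (rule L(2)[OF c], rule L'(2)[OF c])
    have k0: "\<bar>?x 0 * ?y 0 - G\<^sup>2\<bar> \<le> D * S ^ (2 * m)"
    proof -
      have "\<bar>?x 0 * ?y 0 - G\<^sup>2\<bar> \<le> \<bar>?x 0\<bar> * \<bar>?y 0\<bar> + G\<^sup>2" 
        using abs_triangle_ineq4[of "?x 0 * ?y 0" "G\<^sup>2"] by (simp add: abs_mult)
      also have "\<dots> \<le> (L * S ^ m) * (L' * S ^ m) + (\<gamma> * S ^ m)\<^sup>2"
        using x y G L S by (intro add_mono mult_mono power_mono) auto
      also have "\<dots> = D * (S ^ m * S ^ m)" by (simp add: D_def algebra_simps power2_eq_square)
      finally show ?thesis by (simp only: Sm)
    qed
    have k1: "\<bar>?x k * ?y k - G\<^sup>2\<bar> \<le> E * S ^ (2 * m - 1)" if k: "0 < k" "k < n" for k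
    proof -
      have V: "(\<Sum>i<h. (eigen_coeff n k i)\<^sup>2) = real n - 1"
        using sum_eigen_coeff_sq[OF h k(1)] k(2) n by simp
      have "\<bar>?x k - G\<bar> \<le> K * S ^ (m - 1)" "\<bar>?y k - G\<bar> \<le> K' * S ^ (m - 1)"
        using K(2)[OF c, of k] K'(2)[OF c, of k] unfolding V G_def S_def by auto
      moreover have "\<bar>G\<bar> \<le> \<gamma> * S ^ m" using G by simp
      ultimately have "\<bar>?x k * ?y k - G\<^sup>2\<bar> \<le> K * S ^ (m - 1) * (L' * S ^ m) + \<gamma> * S ^ m * (K' * S ^ (m - 1))"
        by (intro abs_prod_diff_le y)
      also have "\<dots> = E * (S ^ (m - 1) * S ^ m)" by (simp add: E_def algebra_simps)
      finally show ?thesis by (simp only: Sm)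
    qed
    have diff: "(\<Sum>k<n. ?x k * ?y k) - real n * G\<^sup>2 = (\<Sum>k<n. ?x k * ?y k - G\<^sup>2)"
      by (simp add: sum_subtractf)
    have "\<bar>\<Sum>k<n. ?x k * ?y k - G\<^sup>2\<bar> \<le> (\<Sum>k<n. (if k = 0 then D * S ^ (2 * m) else 0) + E * S ^ (2 * m - 1))"
    proof (rule order_trans[OF sum_abs], rule sum_mono)
      fix k assume k: "k \<in> {..<n}"
      show "\<bar>?x k * ?y k - G\<^sup>2\<bar> \<le> (if k = 0 then D * S ^ (2 * m) else 0) + E * S ^ (2 * m - 1)"
      proof (cases "k = 0")
        case True
        have "0 \<le> E * S ^ (2 * m - 1)" using E0 S by simp
        from add_mono[OF k0 this] show ?thesis unfolding True by simp
      next
        case False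
        then show ?thesis using k1[of k] k by simp
      qed
    qed
    also have "\<dots> = D * S ^ (2 * m) + real n * (E * S ^ (2 * m - 1))"
      using n0 by (simp only: sum.distrib sum.delta finite_lessThan lessThan_iff if_True sum_constant card_lessThan)
    also have "\<dots> \<le> D * S ^ (2 * m) + (2 * S) * (E * S ^ (2 * m - 1))"
      using E0 S(1,4) by (intro add_left_mono mult_right_mono) auto
    also have "\<dots> = D * S ^ (2 * m) + 2 * E * (S * S ^ (2 * m - 1))"
      by (simp only: mult.assoc mult.left_commute[of S E])
    also have "\<dots> = (D + 2 * E) * S ^ (2 * m)"
      unfolding Sm by (simp only: distrib_right)
    finally show ?thesis unfolding diff[symmetric] unfolding G_def S_def .
  qed
  show ?thesis
    by (rule exI[of _ "D + 2 * E"]) (use D0 E0 main in auto)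
qed

lemma sum_eigen_moments_bound:
  fixes M M' :: "nat \<Rightarrow> real"
  assumes M: "M 0 = 1" "M 1 = 0" "M 2 = 1" and M': "M' 0 = 1" "M' 1 = 0" "M' 2 = 1"
  shows "\<exists>C\<ge>0. \<forall>h n. 0 < h \<longrightarrow> n = 2 * h - 1 \<longrightarrow>
    (\<Sum>k<n. \<Sum>l<n. wsum_moment M (eigen_coeff n k) h (8 * m) * wsum_moment M' (eigen_coeff n l) h (8 * m))
       \<le> C * real (Suc h) ^ (8 * m + 2)"
proof -
  have e: "8 * m div 2 = 4 * m" by simp
  obtain L where L: "0 \<le> L" "\<And>c n. (\<forall>i<n. \<bar>c i\<bar> \<le> 2) \<Longrightarrow>
     \<bar>wsum_moment M c n (8 * m)\<bar> \<le> L * real (Suc n) ^ (4 * m)"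
    using wsum_moment_bound[of M "8 * m"] M unfolding e by blast
  obtain L' where L': "0 \<le> L'" "\<And>c n. (\<forall>i<n. \<bar>c i\<bar> \<le> 2) \<Longrightarrow>
     \<bar>wsum_moment M' c n (8 * m)\<bar> \<le> L' * real (Suc n) ^ (4 * m)"
    using wsum_moment_bound[of M' "8 * m"] M' unfolding e by blast
  have "(\<Sum>k<n. \<Sum>l<n. wsum_moment M (eigen_coeff n k) h (8 * m) * wsum_moment M' (eigen_coeff n l) h (8 * m))
       \<le> 4 * (L * L') * real (Suc h) ^ (8 * m + 2)"
    if h: "0 < h" and n: "n = 2 * h - 1" for h n
  proof -
    define S where "S = real (Suc h)"
    have c: "\<forall>i<h. \<bar>eigen_coeff n k i\<bar> \<le> 2" for k by (simp add: eigen_coeff_le)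
    have S: "0 \<le> S" "real n \<le> 2 * S" using h n by (auto simp: S_def)
    have "wsum_moment M (eigen_coeff n k) h (8 * m) * wsum_moment M' (eigen_coeff n l) h (8 * m)
        \<le> L * S ^ (4 * m) * (L' * S ^ (4 * m))" for k l
    proof (rule order_trans[OF abs_ge_self], unfold abs_mult, rule mult_mono)
      show "\<bar>wsum_moment M (eigen_coeff n k) h (8 * m)\<bar> \<le> L * S ^ (4 * m)"
        unfolding S_def by (rule L(2)[OF c])
      show "\<bar>wsum_moment M' (eigen_coeff n l) h (8 * m)\<bar> \<le> L' * S ^ (4 * m)"
        unfolding S_def by (rule L'(2)[OF c])
    qed (use L S in auto)
    then have "(\<Sum>k<n. \<Sum>l<n. wsum_moment M (eigen_coeff n k) h (8 * m) * wsum_moment M' (eigen_coeff n l) h (8 * m))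
       \<le> (\<Sum>k<n. \<Sum>l<n. L * S ^ (4 * m) * (L' * S ^ (4 * m)))"
      by (intro sum_mono)
    also have "\<dots> = real n * real n * (L * S ^ (4 * m) * (L' * S ^ (4 * m)))" by simp
    also have "\<dots> \<le> (2 * S) * (2 * S) * (L * S ^ (4 * m) * (L' * S ^ (4 * m)))"
      using S L L' by (intro mult_right_mono mult_mono) auto
    also have "\<dots> = 4 * (L * L') * (S ^ (4 * m) * S ^ (4 * m) * S\<^sup>2)"
      by (simp only: power2_eq_square) (simp add: mult_ac)
    also have "S ^ (4 * m) * S ^ (4 * m) * S\<^sup>2 = S ^ (8 * m + 2)"
      by (simp flip: power_add)
    finally show ?thesis unfolding S_def .
  qed
  then show ?thesis using L(1) L'(1) by (intro exI[of _ "4 * (L * L')"]) auto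
qed

lemma tendsto_even_subsequence:
  fixes f :: "nat \<Rightarrow> 'a :: metric_space"
  assumes "(\<lambda>h. f (2 * h)) \<longlonglongrightarrow> L"
  shows "(f \<longlongrightarrow> L) (inf sequentially (principal {N. even N}))"
proof (rule tendstoI)
  fix e :: real assume "0 < e"
  then obtain h0 where h0: "\<And>h. h0 \<le> h \<Longrightarrow> dist (f (2 * h)) L < e"
    using tendstoD[OF assms] by (auto simp: eventually_sequentially)
  have "\<forall>N\<ge>2 * h0. even N \<longrightarrow> dist (f N) L < e"
    using h0 by (auto elim!: evenE)
  then show "\<forall>\<^sub>F N in inf sequentially (principal {N. even N}). dist (f N) L < e"
    unfolding eventually_inf_principal eventually_sequentially by auto
qed

lemma main_term_tendsto:
  fixes c :: real
  shows "(\<lambda>h. real (2 * h - 1) * (c * (real (2 * h - 1) - 1) ^ m)\<^sup>2 / real (2 * h) ^ (2 * m + 1)) \<longlonglongrightarrow> c\<^sup>2"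
proof -
  have "(\<lambda>h::nat. (real (2 * h) - 1) / real (2 * h)) \<longlonglongrightarrow> 1"
    "(\<lambda>h::nat. (real (2 * h) - 2) / real (2 * h)) \<longlonglongrightarrow> 1"
    by real_asymp+
  then have "(\<lambda>h::nat. (real (2 * h) - 1) / real (2 * h) * (c * ((real (2 * h) - 2) / real (2 * h)) ^ m)\<^sup>2)
      \<longlonglongrightarrow> 1 * (c * 1 ^ m)\<^sup>2"
    by (intro tendsto_intros)
  moreover have "eventually (\<lambda>h::nat. (real (2 * h) - 1) / real (2 * h) * (c * ((real (2 * h) - 2) / real (2 * h)) ^ m)\<^sup>2
      = real (2 * h - 1) * (c * (real (2 * h - 1) - 1) ^ m)\<^sup>2 / real (2 * h) ^ (2 * m + 1)) sequentially"
    using eventually_gt_at_top[of 0]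
  proof eventually_elim
    case (elim h)
    then have "real (2 * h - 1) = real (2 * h) - 1" by (simp add: of_nat_diff)
    moreover have "a / q * (c * (b / q) ^ m)\<^sup>2 = a * (c * b ^ m)\<^sup>2 / q ^ (2 * m + 1)" for a b q :: real
      by (simp add: power_divide power_mult_distrib flip: power_mult) (simp add: mult.commute)
    ultimately show ?case by simp
  qed
  ultimately show ?thesis by (simp add: tendsto_cong)
qed

lemma error_term_tendsto:
  fixes C :: real
  shows "(\<lambda>h. C * (real (Suc h) ^ (2 * m) * sqrt (real (Suc h))) / real (2 * h) ^ (2 * m + 1)) \<longlonglongrightarrow> 0"
proof -
  have "(\<lambda>h::nat. real (Suc h) / real (2 * h)) \<longlonglongrightarrow> 1 / 2"
    "(\<lambda>h::nat. sqrt (real (Suc h)) / real (2 * h)) \<longlonglongrightarrow> 0"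
    by real_asymp+
  note lim = this
  have "(\<lambda>h::nat. C * ((real (Suc h) / real (2 * h)) ^ (2 * m) * (sqrt (real (Suc h)) / real (2 * h))))
      \<longlonglongrightarrow> C * ((1 / 2) ^ (2 * m) * 0)"
    by (intro tendsto_mult tendsto_power tendsto_const lim)
  moreover have "C * ((a / q) ^ (2 * m) * (b / q)) = C * (a ^ (2 * m) * b) / q ^ (2 * m + 1)" for a b q :: real
    by (simp add: power_divide mult.commute)
  ultimately show ?thesis by simp
qed

theorem theorem1p11:
  fixes P :: "nat \<Rightarrow> 'w measure"
    and \<mu> \<nu> :: "real measure"
    and A B :: "nat \<Rightarrow> 'w \<Rightarrow> real mat"
    and m :: nat
  assumes "standardized_law \<mu>" and "standardized_law \<nu>"
    and "\<And>N. even N \<Longrightarrow> 2 \<le> N \<Longrightarrow> prob_space (P N)"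
    and "\<And>N. even N \<Longrightarrow> 2 \<le> N \<Longrightarrow> sampled_from_PTE (P N) \<mu> N (A N)"
    and "\<And>N. even N \<Longrightarrow> 2 \<le> N \<Longrightarrow> sampled_from_PTE (P N) \<nu> N (B N)"
    and "\<And>N. even N \<Longrightarrow> 2 \<le> N \<Longrightarrow> independent_matrices (P N) N (A N) (B N)"
  shows "((\<lambda>N. prob_space.expectation (P N)
              (\<lambda>\<omega>. mat_trace (anticommutator (A N \<omega>) (B N \<omega>) ^\<^sub>m (2 * m)))
            / real N ^ (2 * m + 1))
          \<longlongrightarrow> 4 ^ m * (\<Prod>k=1..m. 2 * real k - 1)\<^sup>2)
         (inf sequentially (principal {N. even N}))"
proof (rule tendsto_even_subsequence)
  let ?T = "\<lambda>N. prob_space.expectation (P N)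
      (\<lambda>\<omega>. mat_trace (anticommutator (A N \<omega>) (B N \<omega>) ^\<^sub>m (2 * m)))"
  show "(\<lambda>h. ?T (2 * h) / real (2 * h) ^ (2 * m + 1)) \<longlonglongrightarrow> 4 ^ m * (\<Prod>k=1..m. 2 * real k - 1)\<^sup>2"
  proof (cases "m = 0")
    case True
    have "?T (2 * h) / real (2 * h) ^ (2 * m + 1) = 1" if h: "0 < h" for h
    proof -
      interpret prob_space "P (2 * h)" using assms(3) h by simp
      obtain b where b: "\<And>\<omega>. \<omega> \<in> space (P (2 * h)) \<Longrightarrow>
          B (2 * h) \<omega> = palindromic_toeplitz (2 * h) (\<lambda>k. b k \<omega>)"
        using assms(5)[of "2 * h"] h by (auto simp: sampled_from_PTE_def)
      obtain a where a: "\<And>\<omega>. \<omega> \<in> space (P (2 * h)) \<Longrightarrow>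
          A (2 * h) \<omega> = palindromic_toeplitz (2 * h) (\<lambda>k. a k \<omega>)"
        using assms(4)[of "2 * h"] h by (auto simp: sampled_from_PTE_def)
      have "mat_trace (anticommutator (A (2 * h) \<omega>) (B (2 * h) \<omega>) ^\<^sub>m (2 * m)) = real (2 * h)"
        if "\<omega> \<in> space (P (2 * h))" for \<omega>
        using True by (simp add: a[OF that] b[OF that] anticommutator_def palindromic_toeplitz_def mat_trace_def)
      then have "?T (2 * h) = expectation (\<lambda>_. real (2 * h))"
        by (intro Bochner_Integration.integral_cong) auto
      then show ?thesis using h True by (simp add: prob_space)
    qed
    then have "eventually (\<lambda>h. ?T (2 * h) / real (2 * h) ^ (2 * m + 1) = 1) sequentially"
      using eventually_gt_at_top[of 0] by (rule eventually_mono[rotated])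
    then show ?thesis using True by (simp add: tendsto_eventually)
  next
    case False
    then have m: "0 < m" by simp
    let ?g = "gauss_moment (2 * m)"
    let ?x = "\<lambda>h k. wsum_moment (\<lambda>q. \<integral>x. x ^ q \<partial>\<mu>) (eigen_coeff (2 * h - 1) k) h"
    let ?y = "\<lambda>h k. wsum_moment (\<lambda>q. \<integral>x. x ^ q \<partial>\<nu>) (eigen_coeff (2 * h - 1) k) h"
    let ?main = "\<lambda>h. real (2 * h - 1) * (?g * (real (2 * h - 1) - 1) ^ m)\<^sup>2"
    note mu = standardized_law_moments(1-3)[OF assms(1)] and nu = standardized_law_moments(1-3)[OF assms(2)]
    obtain C where C: "0 \<le> C" "\<And>h. 0 < h \<Longrightarrow>
        \<bar>(\<Sum>k<2*h-1. ?x h k (2 * m) * ?y h k (2 * m)) - ?main h\<bar> \<le> C * real (Suc h) ^ (2 * m)"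
      using sum_eigen_moments_approx[OF mu nu m] by blast
    obtain D where D: "0 \<le> D" "\<And>h. 0 < h \<Longrightarrow>
        (\<Sum>k<2*h-1. \<Sum>l<2*h-1. ?x h k (8 * m) * ?y h l (8 * m)) \<le> D * real (Suc h) ^ (8 * m + 2)"
      using sum_eigen_moments_bound[OF mu nu, of m] by blast
    \<comment> \<open>With \<open>S = h + 1\<close>, the choice \<open>s = S ^ (2 * m) * sqrt S\<close> makes \<open>s\<close> and \<open>S ^ (8 * m + 2) / s ^ 3\<close> equal.
      Both are then of smaller order than \<open>S ^ (2 * m + 1)\<close>.\<close>
    define E where "E = 4 ^ m * C + 64 ^ m * (1 + D)"
    have bound: "\<bar>?T (2 * h) - 4 ^ m * ?main h\<bar> \<le> E * (real (Suc h) ^ (2 * m) * sqrt (real (Suc h)))"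
      if h: "0 < h" for h
    proof -
      interpret prob_space "P (2 * h)" using assms(3) h by simp
      define S where "S = real (Suc h)"
      define s where "s = S ^ (2 * m) * sqrt S"
      have S: "1 \<le> S" by (simp add: S_def)
      then have s: "0 < s" by (simp add: s_def)
      have s3: "S ^ (8 * m + 2) / s ^ 3 = s"
      proof -
        have "(a * q) ^ 3 * (a * q) = a ^ 4 * (q * q)\<^sup>2" for a q :: real
          by (simp add: eval_nat_numeral mult_ac)
        then have "s ^ 3 * s = (S ^ (2 * m)) ^ 4 * (sqrt S * sqrt S) ^ 2"
          unfolding s_def .
        also have "\<dots> = S ^ (8 * m + 2)"
          using S by (simp add: power_add power2_eq_square flip: power_mult)
        finally show ?thesis using s by (simp add: field_simps)
      qed
      have "\<bar>?T (2 * h) - 4 ^ m * (\<Sum>k<2*h-1. ?x h k (2 * m) * ?y h k (2 * m))\<bar>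
          \<le> 64 ^ m * (s + (\<Sum>k<2*h-1. \<Sum>l<2*h-1. ?x h k (8 * m) * ?y h l (8 * m)) / s ^ 3)"
        by (rule pte_expected_trace_bound[OF assms(1,2) _ _ _ h m s refl])
          (use assms(4-6)[of "2 * h"] h in auto)
      also have "\<dots> \<le> 64 ^ m * (s + D * S ^ (8 * m + 2) / s ^ 3)"
        using D(2)[OF h] s unfolding S_def by (intro mult_left_mono add_left_mono divide_right_mono) auto
      also have "\<dots> = 64 ^ m * (s + D * (S ^ (8 * m + 2) / s ^ 3))"
        by (simp only: times_divide_eq_right)
      also have "\<dots> = 64 ^ m * (1 + D) * s"
        unfolding s3 by (simp only: distrib_left distrib_right mult_1_left mult_1_right mult.assoc)
      finally have 1: "\<bar>?T (2 * h) - 4 ^ m * (\<Sum>k<2*h-1. ?x h k (2 * m) * ?y h k (2 * m))\<bar>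
          \<le> 64 ^ m * (1 + D) * s" .
      have "\<bar>4 ^ m * (\<Sum>k<2*h-1. ?x h k (2 * m) * ?y h k (2 * m)) - 4 ^ m * ?main h\<bar>
          = 4 ^ m * \<bar>(\<Sum>k<2*h-1. ?x h k (2 * m) * ?y h k (2 * m)) - ?main h\<bar>"
        by (simp only: right_diff_distrib[symmetric] abs_mult) simp
      also have "\<dots> \<le> 4 ^ m * (C * S ^ (2 * m))"
        unfolding S_def by (intro mult_left_mono C(2)[OF h]) simp
      also have "\<dots> \<le> 4 ^ m * (C * s)"
        unfolding s_def using S C(1) by (intro mult_left_mono) auto
      finally have 2: "\<bar>4 ^ m * (\<Sum>k<2*h-1. ?x h k (2 * m) * ?y h k (2 * m)) - 4 ^ m * ?main h\<bar>
          \<le> 4 ^ m * C * s" by (simp only: mult.assoc)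
      have tri: "\<bar>u - w\<bar> \<le> \<bar>u - v\<bar> + \<bar>v - w\<bar>" for u v w :: real
        by linarith
      have "\<bar>?T (2 * h) - 4 ^ m * ?main h\<bar> \<le> 64 ^ m * (1 + D) * s + 4 ^ m * C * s"
        by (rule order_trans[OF tri add_mono[OF 1 2]])
      also have "\<dots> = E * s" by (simp only: E_def distrib_right add.commute)
      finally show ?thesis unfolding s_def S_def .
    qed
    have tendsto_of_diff: "f \<longlonglongrightarrow> l" if "(\<lambda>h. f h - g h) \<longlonglongrightarrow> 0" "g \<longlonglongrightarrow> l" for f g :: "nat \<Rightarrow> real" and l
      using tendsto_add[OF that] by simp
    have "(\<lambda>h. ?T (2 * h) / real (2 * h) ^ (2 * m + 1) - 4 ^ m * (?main h / real (2 * h) ^ (2 * m + 1))) \<longlonglongrightarrow> 0"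
    proof (rule Lim_null_comparison[OF _ error_term_tendsto[of E m]])
      show "\<forall>\<^sub>F h in sequentially. norm (?T (2 * h) / real (2 * h) ^ (2 * m + 1)
              - 4 ^ m * (?main h / real (2 * h) ^ (2 * m + 1)))
          \<le> E * (real (Suc h) ^ (2 * m) * sqrt (real (Suc h))) / real (2 * h) ^ (2 * m + 1)"
        using eventually_gt_at_top[of 0]
      proof eventually_elim
        case (elim h)
        have "norm (t / q - 4 ^ m * (u / q)) = \<bar>t - 4 ^ m * u\<bar> / q" if "0 \<le> q" for t u q :: real
          using that by (simp add: abs_divide flip: diff_divide_distrib)
        then show ?case using divide_right_mono[OF bound[OF elim], of "real (2 * h) ^ (2 * m + 1)"]
          by simp
      qed
    qed
    moreover have "(\<lambda>h. 4 ^ m * (?main h / real (2 * h) ^ (2 * m + 1))) \<longlonglongrightarrow> 4 ^ m * ?g\<^sup>2"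
      by (rule tendsto_mult[OF tendsto_const main_term_tendsto])
    ultimately have "(\<lambda>h. ?T (2 * h) / real (2 * h) ^ (2 * m + 1)) \<longlonglongrightarrow> 4 ^ m * ?g\<^sup>2"
      by (rule tendsto_of_diff)
    then show ?thesis by (simp add: gauss_moment_def)
  qed
qed

end
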